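(* For every finite simplicial complex $\Delta$, the extreme local rank of $\Delta$ is at most its chordal deficiency: $$\operatorname{elocr}(\Delta)\le\rho(\Delta).$$
   Context: A simplicial complex $\Delta$ on a finite vertex set $V(\Delta)$ is a family of subsets of $V(\Delta)$ (called faces) that is closed under taking subsets and contains all singletons. Let $I(\Delta)\subseteq\mathbb{R}[x_i:i\in V(\Delta)]$ be the ideal generated by the monomials $\prod_{i\in S}x_i$ with $S\subseteq V(\Delta)$, $S\notin\Delta$, and let $R_d(\Delta)$ be the degree $d$ homogeneous part of $\mathbb{R}[x_i:i\in V(\Delta)]/I(\Delta)$. Elements of $R_d(\Delta)$ are regarded as functions on $\bigcup_{F\in\Delta}\operatorname{span}\{e_i:i\in F\}\subseteq\mathbb{R}^{V(\Delta)}$. Let $\mathcal{P}(\Delta)\subseteq R_2(\Delta)$ be the convex cone of quadratic forms that are nonnegative on this union, and $\Sigma(\Delta)\subseteq\mathcal{P}(\Delta)$ the cone of sums of squares of elements of $R_1(\Delta)$. A nonzero element $x$ of a convex cone $C$ spans an extreme ray if there are no linearly independent $y,z\in C$ with $x=y+z$. The rank of a sum-of-squares form is the least $k$ such that it is a sum of $k$ squares of linear forms. For $q\in\mathcal{P}(\Delta)$ the local rank is $\operatorname{locr}(q)=\max_{F\in\Delta}\operatorname{rank}(q|_{\operatorname{span}\{e_i:i\in F\}})$. A complex is chordal if it is the clique complex (faces are the vertex sets of cliques) of a chordal graph, i.e. a graph with no induced cycle of length at least 4. The extreme local rank $\operatorname{elocr}(\Delta)$ is the maximum of $\operatorname{locr}(q)$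 over those $q\in\mathcal{P}(\Delta)\setminus\Sigma(\Delta)$ which span an extreme ray of $\mathcal{P}(\Delta)$; it is defined to be $0$ if $\Delta$ is chordal. A simplicial map $\phi:\Gamma\to\Delta$ is a map $V(\Gamma)\to V(\Delta)$ taking faces to faces. It is a chordal quotient if $\Gamma$ is chordal and every face $S\in\Delta$ is of the form $\phi(T)$ for some face $T\in\Gamma$. The chordal deficiency of $\Delta$ is $$\rho(\Delta)=\min\{|V(\Gamma)|-|V(\Delta)| : \phi:\Gamma\to\Delta\text{ is a chordal quotient}\}.$$ *)

theory Defs
  imports Complex_Main "HOL-Library.Poly_Mapping" "HOL-Algebra.QuotRing"
begin

section \<open>Simplicial complexes, chordality and chordal quotients\<close>

text \<open>
  A complex is given by its family of faces. As it contains all singletons, its vertex set is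
  the union of the faces. The void complex is allowed.
\<close>

definition vertices :: "'a set set \<Rightarrow> 'a set" where
  "vertices \<Delta> = \<Union>\<Delta>"

definition simplicial_complex :: "'a set set \<Rightarrow> bool" where
  "simplicial_complex \<Delta> \<longleftrightarrow> finite (vertices \<Delta>) \<and> (\<forall>F\<in>\<Delta>. \<forall>S. S \<subseteq> F \<longrightarrow> S \<in> \<Delta>)"

lemma simplicial_complex_singleton:
  "simplicial_complex \<Delta> \<Longrightarrow> v \<in> vertices \<Delta> \<Longrightarrow> {v} \<in> \<Delta>"
  by (fastforce simp: simplicial_complex_def vertices_def)

lemma simplicial_complex_finite: "simplicial_complex \<Delta> \<Longrightarrow> finite \<Delta>"
  by (auto simp: simplicial_complex_def vertices_def intro: finite_UnionD)

definition simple_graph :: "'a set \<Rightarrow> 'a set set \<Rightarrow> bool" where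
  "simple_graph V E \<longleftrightarrow> finite V \<and> (\<forall>e\<in>E. e \<subseteq> V \<and> card e = 2)"

definition induced_cycle :: "'a set \<Rightarrow> 'a set set \<Rightarrow> 'a list \<Rightarrow> bool" where
  "induced_cycle V E c \<longleftrightarrow> 3 \<le> length c \<and> distinct c \<and> set c \<subseteq> V \<and>
     (\<forall>i<length c. \<forall>j<length c.
        {c ! i, c ! j} \<in> E \<longleftrightarrow> j = (i + 1) mod length c \<or> i = (j + 1) mod length c)"

definition chordal_graph :: "'a set \<Rightarrow> 'a set set \<Rightarrow> bool" where
  "chordal_graph V E \<longleftrightarrow> simple_graph V E \<and> \<not> (\<exists>c. induced_cycle V E c \<and> 4 \<le> length c)"

definition clique_complex :: "'a set \<Rightarrow> 'a set set \<Rightarrow> 'a set set" where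
  "clique_complex V E = {S. S \<subseteq> V \<and> (\<forall>u\<in>S. \<forall>v\<in>S. u \<noteq> v \<longrightarrow> {u, v} \<in> E)}"

definition chordal_complex :: "'a set set \<Rightarrow> bool" where
  "chordal_complex \<Delta> \<longleftrightarrow> (\<exists>V E. chordal_graph V E \<and> \<Delta> = clique_complex V E)"

definition simplicial_map :: "'b set set \<Rightarrow> ('b \<Rightarrow> 'a) \<Rightarrow> 'a set set \<Rightarrow> bool" where
  "simplicial_map \<Gamma> \<phi> \<Delta> \<longleftrightarrow> \<phi> \<in> vertices \<Gamma> \<rightarrow> vertices \<Delta> \<and> (\<forall>T\<in>\<Gamma>. \<phi> ` T \<in> \<Delta>)"

definition chordal_quotient :: "'b set set \<Rightarrow> ('b \<Rightarrow> 'a) \<Rightarrow> 'a set set \<Rightarrow> bool" where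
  "chordal_quotient \<Gamma> \<phi> \<Delta> \<longleftrightarrow> chordal_complex \<Gamma> \<and> simplicial_map \<Gamma> \<phi> \<Delta> \<and>
     (\<forall>S\<in>\<Delta>. \<exists>T\<in>\<Gamma>. S = \<phi> ` T)"

text \<open>
  The infimum of a nonempty set of naturals is its minimum. Vertices of \<open>\<Gamma>\<close> are taken in
  \<^typ>\<open>nat\<close>, without loss of generality (see \<open>chordal_deficiency_le\<close> below), and the subtraction
  does not truncate (see \<open>chordal_quotient_card_le\<close>).
\<close>

definition chordal_deficiency :: "'a set set \<Rightarrow> nat" where
  "chordal_deficiency \<Delta> =
     Inf {card (vertices \<Gamma>) - card (vertices \<Delta>) | (\<Gamma> :: nat set set) \<phi>. chordal_quotient \<Gamma> \<phi> \<Delta>}"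

lemma vertices_clique_complex [simp]: "vertices (clique_complex V E) = V"
proof
  show "V \<subseteq> vertices (clique_complex V E)"
  proof
    fix v assume "v \<in> V"
    then have "{v} \<in> clique_complex V E" by (simp add: clique_complex_def)
    then show "v \<in> vertices (clique_complex V E)" unfolding vertices_def by blast
  qed
qed (auto simp: vertices_def clique_complex_def)

lemma chordal_complex_simplicial: "chordal_complex \<Delta> \<Longrightarrow> simplicial_complex \<Delta>"
  unfolding chordal_complex_def simplicial_complex_def chordal_graph_def simple_graph_def
  by (safe, simp, unfold clique_complex_def, blast)

lemma chordal_quotient_card_le:
  assumes "chordal_quotient \<Gamma> \<phi> \<Delta>"
  shows "card (vertices \<Delta>) \<le> card (vertices \<Gamma>)"
proof (rule surj_card_le)
  show "finite (vertices \<Gamma>)"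
    using assms chordal_complex_simplicial
    unfolding chordal_quotient_def simplicial_complex_def by blast
  show "vertices \<Delta> \<subseteq> \<phi> ` vertices \<Gamma>"
    using assms unfolding chordal_quotient_def vertices_def by blast
qed

lemma chordal_complex_image:
  assumes ch: "chordal_complex \<Gamma>" and inj: "inj_on f (vertices \<Gamma>)"
  shows "chordal_complex ((`) f ` \<Gamma>)"
proof -
  from ch obtain V E where G: "chordal_graph V E" and \<Gamma>: "\<Gamma> = clique_complex V E"
    unfolding chordal_complex_def by blast
  have inj: "inj_on f V" using inj \<Gamma> by simp
  have E: "e \<subseteq> V" "card e = 2" if "e \<in> E" for e
    using G that unfolding chordal_graph_def simple_graph_def by auto
  let ?E = "(`) f ` E"
  have edge: "{f u, f v} \<in> ?E \<longleftrightarrow> {u, v} \<in> E" if "u \<in> V" "v \<in> V" for u v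
  proof
    assume "{f u, f v} \<in> ?E"
    then obtain e where e: "e \<in> E" "f ` {u, v} = f ` e" by auto
    with that E(1) inj have "e = {u, v}"
      by (metis empty_subsetI inj_on_image_eq_iff insert_subset)
    with e show "{u, v} \<in> E" by simp
  qed (use image_iff in fastforce)
  have "simple_graph (f ` V) ?E"
    using G E inj unfolding chordal_graph_def simple_graph_def
    by (auto simp: card_image inj_on_subset)
  moreover have "\<not> induced_cycle (f ` V) ?E c" if "4 \<le> length c" for c
  proof
    assume c: "induced_cycle (f ` V) ?E c"
    let ?g = "inv_into V f"
    have sub: "set c \<subseteq> f ` V" and dist: "distinct c" using c unfolding induced_cycle_def by auto
    have g: "?g (c ! i) \<in> V" "f (?g (c ! i)) = c ! i" if "i < length c" for i
      using sub that by (meson inv_into_into nth_mem subsetD, meson f_inv_into_f nth_mem subsetD)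
    have "inj_on ?g (set c)" using sub by (rule inj_on_inv_into)
    moreover have "{?g (c ! i), ?g (c ! j)} \<in> E \<longleftrightarrow> {c ! i, c ! j} \<in> ?E"
      if "i < length c" "j < length c" for i j
      using edge g that by metis
    ultimately have "induced_cycle V E (map ?g c)"
      using c sub dist unfolding induced_cycle_def
      by (auto simp: distinct_map inv_into_into)
    with G that show False unfolding chordal_graph_def by auto
  qed
  moreover have "(`) f ` \<Gamma> = clique_complex (f ` V) ?E"
  proof (intro equalityI subsetI)
    fix S assume "S \<in> (`) f ` \<Gamma>"
    then obtain T where T: "T \<subseteq> V" "\<forall>u\<in>T. \<forall>v\<in>T. u \<noteq> v \<longrightarrow> {u, v} \<in> E" "S = f ` T"
      by (auto simp: \<Gamma> clique_complex_def)
    have "{f u, f v} \<in> ?E" if "u \<in> T" "v \<in> T" "f u \<noteq> f v" for u v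
      using that T edge by (metis subsetD)
    with T show "S \<in> clique_complex (f ` V) ?E" by (auto simp: clique_complex_def)
  next
    fix S assume S: "S \<in> clique_complex (f ` V) ?E"
    then obtain T where T: "T \<subseteq> V" "S = f ` T"
      by (auto simp: clique_complex_def subset_image_iff)
    have "{u, v} \<in> E" if "u \<in> T" "v \<in> T" "u \<noteq> v" for u v
    proof -
      have uv: "u \<in> V" "v \<in> V" using that T by auto
      with inj that have "f u \<noteq> f v" by (auto dest: inj_onD)
      with S T that have "{f u, f v} \<in> ?E" by (auto simp: clique_complex_def)
      with edge uv show ?thesis by blast
    qed
    with T show "S \<in> (`) f ` \<Gamma>" by (auto simp: \<Gamma> clique_complex_def)
  qed
  ultimately show ?thesis unfolding chordal_complex_def chordal_graph_def by blast
qed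

lemma chordal_deficiency_le:
  fixes \<Gamma> :: "'b set set"
  assumes q: "chordal_quotient \<Gamma> \<phi> \<Delta>"
  shows "chordal_deficiency \<Delta> \<le> card (vertices \<Gamma>) - card (vertices \<Delta>)"
proof -
  have fin: "finite (vertices \<Gamma>)"
    using q chordal_complex_simplicial
    unfolding chordal_quotient_def simplicial_complex_def by blast
  then obtain f :: "'b \<Rightarrow> nat" where f: "inj_on f (vertices \<Gamma>)"
    using finite_imp_inj_to_nat_seg by metis
  let ?G = "(`) f ` \<Gamma>"
  let ?g = "inv_into (vertices \<Gamma>) f"
  have vert: "vertices ?G = f ` vertices \<Gamma>" by (auto simp: vertices_def)
  have pull: "(\<phi> \<circ> ?g) ` (f ` T) = \<phi> ` T" if "T \<in> \<Gamma>" for T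
  proof -
    have "?g (f t) = t" if "t \<in> T" for t
      using that \<open>T \<in> \<Gamma>\<close> f by (auto intro!: inv_into_f_f simp: vertices_def)
    then show ?thesis by (simp add: image_image)
  qed
  have "chordal_quotient ?G (\<phi> \<circ> ?g) \<Delta>"
    unfolding chordal_quotient_def
  proof (intro conjI)
    show "chordal_complex ?G"
      using q f by (intro chordal_complex_image) (auto simp: chordal_quotient_def)
    show "simplicial_map ?G (\<phi> \<circ> ?g) \<Delta>"
      using q pull f unfolding chordal_quotient_def simplicial_map_def vert
      by (auto simp: Pi_iff simp del: image_comp comp_apply) (auto simp: inv_into_f_f)
    show "\<forall>S\<in>\<Delta>. \<exists>T\<in>?G. S = (\<phi> \<circ> ?g) ` T"
      using q pull unfolding chordal_quotient_def by (metis image_eqI)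
  qed
  moreover have "card (vertices ?G) = card (vertices \<Gamma>)"
    unfolding vert using f by (rule card_image)
  ultimately show ?thesis
    unfolding chordal_deficiency_def by (intro cInf_lower) (auto, metis)
qed

section \<open>The face ring\<close>

text \<open>
  Polynomials are finitely supported maps from exponent vectors to coefficients; the product of
  \<^theory>\<open>HOL-Library.Poly_Mapping\<close> is the convolution.
\<close>

type_synonym 'a rpoly = "('a \<Rightarrow>\<^sub>0 nat) \<Rightarrow>\<^sub>0 real"

definition poly_ring :: "'a set \<Rightarrow> 'a rpoly ring" where
  "poly_ring V = \<lparr>carrier = {p. \<forall>m\<in>Poly_Mapping.keys p. Poly_Mapping.keys m \<subseteq> V},
     mult = (*), one = 1, zero = 0, add = (+)\<rparr>"

definition var :: "'a \<Rightarrow> 'a rpoly" where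
  "var i = Poly_Mapping.single (Poly_Mapping.single i 1) 1"

definition const :: "real \<Rightarrow> 'a rpoly" where
  "const c = Poly_Mapping.single 0 c"

definition homogeneous :: "nat \<Rightarrow> 'a rpoly \<Rightarrow> bool" where
  "homogeneous d p \<longleftrightarrow>
     (\<forall>m\<in>Poly_Mapping.keys p. (\<Sum>i\<in>Poly_Mapping.keys m. Poly_Mapping.lookup m i) = d)"

definition poly_eval :: "'a rpoly \<Rightarrow> ('a \<Rightarrow> real) \<Rightarrow> real" where
  "poly_eval p x = (\<Sum>m\<in>Poly_Mapping.keys p. Poly_Mapping.lookup p m *
     (\<Prod>i\<in>Poly_Mapping.keys m. x i ^ Poly_Mapping.lookup m i))"

definition face_ideal :: "'a set set \<Rightarrow> 'a rpoly set" where
  "face_ideal \<Delta> =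
     Idl\<^bsub>poly_ring (vertices \<Delta>)\<^esub> {\<Prod>i\<in>S. var i | S. S \<subseteq> vertices \<Delta> \<and> S \<notin> \<Delta>}"

definition face_ring :: "'a set set \<Rightarrow> 'a rpoly set ring" where
  "face_ring \<Delta> = poly_ring (vertices \<Delta>) Quot face_ideal \<Delta>"

definition residue_class :: "'a set set \<Rightarrow> 'a rpoly \<Rightarrow> 'a rpoly set" where
  "residue_class \<Delta> p = face_ideal \<Delta> +>\<^bsub>poly_ring (vertices \<Delta>)\<^esub> p"

definition forms :: "nat \<Rightarrow> 'a set set \<Rightarrow> 'a rpoly set set" where
  "forms d \<Delta> = residue_class \<Delta> ` {p \<in> carrier (poly_ring (vertices \<Delta>)). homogeneous d p}"

definition scale :: "'a set set \<Rightarrow> real \<Rightarrow> 'a rpoly set \<Rightarrow> 'a rpoly set" where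
  "scale \<Delta> c q = residue_class \<Delta> (const c) \<otimes>\<^bsub>face_ring \<Delta>\<^esub> q"

text \<open>The span of the \<open>e\<^sub>i\<close> with \<open>i \<in> F\<close>.\<close>

definition coord_space :: "'a set \<Rightarrow> ('a \<Rightarrow> real) set" where
  "coord_space F = {x. \<forall>i. i \<notin> F \<longrightarrow> x i = 0}"

definition realization :: "'a set set \<Rightarrow> ('a \<Rightarrow> real) set" where
  "realization \<Delta> = (\<Union>F\<in>\<Delta>. coord_space F)"

text \<open>
  On \<^term>\<open>realization \<Delta>\<close> the value does not depend on the representative
  (see \<open>class_eval_residue_class\<close> below).
\<close>

definition class_eval :: "'a rpoly set \<Rightarrow> ('a \<Rightarrow> real) \<Rightarrow> real" where
  "class_eval q x = poly_eval (SOME p. p \<in> q) x"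

lemma poly_ring_cring: "cring (poly_ring V)"
proof (rule cringI)
  show "abelian_group (poly_ring V)"
  proof (rule abelian_groupI)
    fix p assume "p \<in> carrier (poly_ring V)"
    then show "\<exists>q\<in>carrier (poly_ring V). q \<oplus>\<^bsub>poly_ring V\<^esub> p = \<zero>\<^bsub>poly_ring V\<^esub>"
      by (intro bexI[of _ "- p"]) (auto simp: poly_ring_def)
  next
    fix p q assume "p \<in> carrier (poly_ring V)" "q \<in> carrier (poly_ring V)"
    then show "p \<oplus>\<^bsub>poly_ring V\<^esub> q \<in> carrier (poly_ring V)"
      using Poly_Mapping.keys_add[of p q] unfolding poly_ring_def by fastforce
  qed (auto simp: poly_ring_def algebra_simps)
  show "Group.comm_monoid (poly_ring V)"
  proof (rule comm_monoidI)
    fix p q assume pq: "p \<in> carrier (poly_ring V)" "q \<in> carrier (poly_ring V)"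
    have "Poly_Mapping.keys m \<subseteq> V" if m: "m \<in> Poly_Mapping.keys (p * q)" for m
    proof -
      from m keys_mult[of p q] obtain a b where
        "m = a + b" "a \<in> Poly_Mapping.keys p" "b \<in> Poly_Mapping.keys q" by blast
      then show ?thesis
        using pq Poly_Mapping.keys_add[of a b] unfolding poly_ring_def by fastforce
    qed
    then show "p \<otimes>\<^bsub>poly_ring V\<^esub> q \<in> carrier (poly_ring V)" by (simp add: poly_ring_def)
  qed (auto simp: poly_ring_def algebra_simps)
qed (auto simp: poly_ring_def algebra_simps)

lemma monomials_in_poly_ring:
  "{\<Prod>i\<in>S. var i | S. S \<subseteq> V \<and> S \<notin> \<Delta>} \<subseteq> carrier (poly_ring V)"
proof -
  interpret cring "poly_ring V" by (rule poly_ring_cring)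
  have "(\<Prod>i\<in>S. var i) \<in> carrier (poly_ring V)" if "S \<subseteq> V" for S
    using that
  proof (induction S rule: infinite_finite_induct)
    case (insert i S)
    then have "var i \<in> carrier (poly_ring V)" by (simp add: var_def poly_ring_def)
    with insert show ?case using m_closed[of "var i" "\<Prod>i\<in>S. var i"] by (simp add: poly_ring_def)
  qed (use one_closed in \<open>auto simp: poly_ring_def\<close>)
  then show ?thesis by auto
qed

lemma ideal_face_ideal: "ideal (face_ideal \<Delta>) (poly_ring (vertices \<Delta>))"
  unfolding face_ideal_def
  by (intro ring.genideal_ideal cring.axioms(1) poly_ring_cring monomials_in_poly_ring)

lemma cring_face_ring: "cring (face_ring \<Delta>)"
  unfolding face_ring_def by (rule ideal.quotient_is_cring[OF ideal_face_ideal poly_ring_cring])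

lemma monomial_eval:
  assumes "finite A" "Poly_Mapping.keys m \<subseteq> A"
  shows "(\<Prod>i\<in>Poly_Mapping.keys m. x i ^ Poly_Mapping.lookup m i) =
    (\<Prod>i\<in>A. (x i :: real) ^ Poly_Mapping.lookup m i)"
  using assms by (intro prod.mono_neutral_left) (auto simp: in_keys_iff)

lemma poly_eval_superset:
  assumes "finite A" "Poly_Mapping.keys p \<subseteq> A"
  shows "poly_eval p x = (\<Sum>m\<in>A. Poly_Mapping.lookup p m *
     (\<Prod>i\<in>Poly_Mapping.keys m. x i ^ Poly_Mapping.lookup m i))"
  unfolding poly_eval_def using assms by (intro sum.mono_neutral_left) (auto simp: in_keys_iff)

lemma poly_eval_0 [simp]: "poly_eval 0 x = 0"
  by (simp add: poly_eval_def)

lemma poly_eval_add: "poly_eval (p + q) x = poly_eval p x + poly_eval q x"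
proof -
  let ?A = "Poly_Mapping.keys p \<union> Poly_Mapping.keys q"
  have "poly_eval r x = (\<Sum>m\<in>?A. Poly_Mapping.lookup r m *
     (\<Prod>i\<in>Poly_Mapping.keys m. x i ^ Poly_Mapping.lookup m i))"
    if "Poly_Mapping.keys r \<subseteq> ?A" for r
    using that by (intro poly_eval_superset) auto
  from this[of p] this[of q] this[of "p + q"] show ?thesis
    using Poly_Mapping.keys_add[of p q] by (simp add: lookup_add distrib_right sum.distrib)
qed

lemma poly_eval_sum: "poly_eval (\<Sum>a\<in>A. f a) x = (\<Sum>a\<in>A. poly_eval (f a) x)"
  by (induction A rule: infinite_finite_induct) (simp_all add: poly_eval_add)

lemma poly_eval_single:
  "poly_eval (Poly_Mapping.single m c) x =
     c * (\<Prod>i\<in>Poly_Mapping.keys m. x i ^ Poly_Mapping.lookup m i)"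
  by (simp add: poly_eval_def)

lemma poly_eval_const [simp]: "poly_eval (const c) x = c"
  by (simp add: const_def poly_eval_single)

lemma poly_eval_var [simp]: "poly_eval (var i) x = x i"
  by (simp add: var_def poly_eval_single)

lemma rpoly_sum_monomials:
  "(\<Sum>m\<in>Poly_Mapping.keys p. Poly_Mapping.single m (Poly_Mapping.lookup p m)) = (p :: 'a rpoly)"
  by (rule poly_mapping_eqI) (auto simp: lookup_sum lookup_single when_def in_keys_iff)

lemma poly_eval_mult: "poly_eval (p * q) x = poly_eval p x * poly_eval q x"
proof -
  let ?mono = "\<lambda>m. \<Prod>i\<in>Poly_Mapping.keys m. x i ^ Poly_Mapping.lookup m i"
  have mono: "?mono (a + b) = ?mono a * ?mono b" for a b
  proof -
    let ?A = "Poly_Mapping.keys a \<union> Poly_Mapping.keys b"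
    have "?mono m = (\<Prod>i\<in>?A. x i ^ Poly_Mapping.lookup m i)" if "Poly_Mapping.keys m \<subseteq> ?A" for m
      using that by (intro monomial_eval) auto
    from this[of a] this[of b] this[of "a + b"] show ?thesis
      using Poly_Mapping.keys_add[of a b] by (simp add: lookup_add power_add prod.distrib)
  qed
  let ?s = "\<lambda>p m. Poly_Mapping.single m (Poly_Mapping.lookup p m)"
  have "p * q = (\<Sum>a\<in>Poly_Mapping.keys p. ?s p a) * (\<Sum>b\<in>Poly_Mapping.keys q. ?s q b)"
    by (simp only: rpoly_sum_monomials)
  also have "poly_eval \<dots> x = poly_eval p x * poly_eval q x"
    by (simp add: sum_product poly_eval_sum mult_single poly_eval_single mono
        poly_eval_def[of p] poly_eval_def[of q] mult_ac)
  finally show ?thesis .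
qed

lemma poly_eval_prod: "poly_eval (\<Prod>a\<in>A. f a) x = (\<Prod>a\<in>A. poly_eval (f a) x)"
proof -
  have "poly_eval 1 x = 1" using poly_eval_const[of 1 x] by (simp add: const_def)
  then show ?thesis
    by (induction A rule: infinite_finite_induct) (simp_all add: poly_eval_mult)
qed

lemma face_ideal_eval:
  assumes \<Delta>: "simplicial_complex \<Delta>" and x: "x \<in> realization \<Delta>" and p: "p \<in> face_ideal \<Delta>"
  shows "poly_eval p x = 0"
proof -
  let ?R = "poly_ring (vertices \<Delta>)"
  interpret cring ?R by (rule poly_ring_cring)
  let ?J = "{p \<in> carrier ?R. poly_eval p x = 0}"
  have R: "add ?R = (+)" "mult ?R = (*)" "zero ?R = 0" by (simp_all add: poly_ring_def)
  have neg: "\<ominus>\<^bsub>?R\<^esub> p = - p" if "p \<in> carrier ?R" for p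
  proof -
    have "- p \<in> carrier ?R" using that by (simp add: poly_ring_def)
    then show ?thesis using that by (intro minus_equality) (simp_all add: R)
  qed
  have "ideal ?J ?R"
  proof (rule idealI[OF ring_axioms])
    show "subgroup ?J (add_monoid ?R)"
    proof (rule group.subgroupI[OF add.is_group])
      show "?J \<noteq> {}" using zero_closed by (auto simp: R intro!: exI[of _ 0])
    next
      fix p assume p: "p \<in> ?J"
      have "poly_eval (- p) x = 0"
        using p poly_eval_add[of p "- p" x] by simp
      then show "inv\<^bsub>add_monoid ?R\<^esub> p \<in> ?J"
        using p neg[of p] a_inv_closed[of p] by (simp add: a_inv_def)
    qed (use a_closed in \<open>auto simp: R poly_eval_add\<close>)
  qed (use m_closed in \<open>auto simp: R poly_eval_mult\<close>)
  moreover have "{\<Prod>i\<in>S. var i | S. S \<subseteq> vertices \<Delta> \<and> S \<notin> \<Delta>} \<subseteq> ?J"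
  proof -
    from x obtain F where F: "F \<in> \<Delta>" "\<And>i. i \<notin> F \<Longrightarrow> x i = 0"
      by (auto simp: realization_def coord_space_def)
    have "(\<Prod>i\<in>S. x i) = 0" if S: "S \<subseteq> vertices \<Delta>" "S \<notin> \<Delta>" for S
    proof -
      have "\<not> S \<subseteq> F" using S F \<Delta> unfolding simplicial_complex_def by blast
      moreover have "finite S" using S \<Delta> unfolding simplicial_complex_def
        by (blast intro: finite_subset)
      ultimately show ?thesis using F(2) by auto
    qed
    then show ?thesis using monomials_in_poly_ring[of "vertices \<Delta>" \<Delta>]
      by (auto simp: poly_eval_prod)
  qed
  ultimately have "face_ideal \<Delta> \<subseteq> ?J" unfolding face_ideal_def by (rule genideal_minimal)
  with p show ?thesis by blast
qed

lemma class_eval_residue_class: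
  assumes "simplicial_complex \<Delta>" "x \<in> realization \<Delta>" "p \<in> carrier (poly_ring (vertices \<Delta>))"
  shows "class_eval (residue_class \<Delta> p) x = poly_eval p x"
proof -
  let ?R = "poly_ring (vertices \<Delta>)"
  have res: "residue_class \<Delta> p = {h + p | h. h \<in> face_ideal \<Delta>}"
    unfolding residue_class_def a_r_coset_def' by (auto simp: poly_ring_def)
  interpret ideal "face_ideal \<Delta>" ?R by (rule ideal_face_ideal)
  have "residue_class \<Delta> p \<noteq> {}" using a_Hcarr zero_closed additive_subgroup.zero_closed
    unfolding res by (metis (mono_tags, lifting) additive_subgroup_axioms empty_iff mem_Collect_eq)
  then have "(SOME p'. p' \<in> residue_class \<Delta> p) \<in> residue_class \<Delta> p" by (simp add: some_in_eq)
  then obtain h where "h \<in> face_ideal \<Delta>" "(SOME p'. p' \<in> residue_class \<Delta> p) = h + p"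
    unfolding res by blast
  then show ?thesis
    using face_ideal_eval[OF assms(1,2)] by (simp add: class_eval_def poly_eval_add)
qed

section \<open>Nonnegative quadratic forms, sums of squares and local rank\<close>

definition nonneg_forms :: "'a set set \<Rightarrow> 'a rpoly set set" where
  "nonneg_forms \<Delta> = {q \<in> forms 2 \<Delta>. \<forall>x\<in>realization \<Delta>. 0 \<le> class_eval q x}"

definition sos_forms :: "'a set set \<Rightarrow> 'a rpoly set set" where
  "sos_forms \<Delta> =
     {finsum (face_ring \<Delta>) (\<lambda>j. l j \<otimes>\<^bsub>face_ring \<Delta>\<^esub> l j) {..<k} | (k :: nat) l.
        \<forall>j<k. l j \<in> forms 1 \<Delta>}"

definition lin_indep2 :: "'a set set \<Rightarrow> 'a rpoly set \<Rightarrow> 'a rpoly set \<Rightarrow> bool" where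
  "lin_indep2 \<Delta> y z \<longleftrightarrow>
     (\<forall>a b. scale \<Delta> a y \<oplus>\<^bsub>face_ring \<Delta>\<^esub> scale \<Delta> b z = \<zero>\<^bsub>face_ring \<Delta>\<^esub> \<longrightarrow> a = 0 \<and> b = 0)"

definition spans_extreme_ray :: "'a set set \<Rightarrow> 'a rpoly set set \<Rightarrow> 'a rpoly set \<Rightarrow> bool" where
  "spans_extreme_ray \<Delta> C x \<longleftrightarrow> x \<in> C \<and> x \<noteq> \<zero>\<^bsub>face_ring \<Delta>\<^esub> \<and>
     \<not> (\<exists>y\<in>C. \<exists>z\<in>C. lin_indep2 \<Delta> y z \<and> x = y \<oplus>\<^bsub>face_ring \<Delta>\<^esub> z)"

text \<open>
  The rank of the restriction of a function \<open>f\<close> to \<^term>\<open>coord_space F\<close>, which is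
  meant to be a sum of squares of linear forms in the variables indexed by \<open>F\<close>. Restrictions of
  elements of \<^term>\<open>nonneg_forms \<Delta>\<close> are positive semidefinite quadratic forms, hence of this kind.
\<close>

definition sos_rank :: "'a set \<Rightarrow> (('a \<Rightarrow> real) \<Rightarrow> real) \<Rightarrow> nat" where
  "sos_rank F f = (LEAST k. \<exists>l :: nat \<Rightarrow> 'a rpoly.
     (\<forall>j<k. l j \<in> carrier (poly_ring F) \<and> homogeneous 1 (l j)) \<and>
     (\<forall>x\<in>coord_space F. f x = (\<Sum>j<k. (poly_eval (l j) x)\<^sup>2)))"

definition local_rank :: "'a set set \<Rightarrow> 'a rpoly set \<Rightarrow> nat" where
  "local_rank \<Delta> q = Max ((\<lambda>F. sos_rank F (class_eval q)) ` \<Delta>)"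

text \<open>
  The supremum of a nonempty bounded set of naturals is its maximum; local ranks are at most the
  number of vertices. The supremum of the empty set, which is \<open>0\<close>, is only relevant for
  the void complex: every other non-chordal complex has an extreme ray that is not a sum of squares.
\<close>

definition extreme_local_rank :: "'a set set \<Rightarrow> nat" where
  "extreme_local_rank \<Delta> =
     (if chordal_complex \<Delta> then 0
      else Sup (local_rank \<Delta> ` {q \<in> nonneg_forms \<Delta> - sos_forms \<Delta>.
                                   spans_extreme_ray \<Delta> (nonneg_forms \<Delta>) q}))"

end

theory Submission
  imports Defs
begin

text \<open>
  Pull an extreme form \<open>q\<close> that is not a sum of squares back along a chordal quotient
  \<open>\<phi> : \<Gamma> \<rightarrow> \<Delta>\<close>. The result is nonnegative on the chordal complex \<open>\<Gamma>\<close>, so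
  by positive semidefinite completion it is a sum of squares \<open>l\<^sub>1\<^sup>2 + \<dots> + l\<^sub>m\<^sup>2\<close> there;
  take \<open>m\<close> minimal, so that the \<open>l\<^sub>k\<close> are independent. If \<open>m > |V(\<Gamma>)| - |V(\<Delta>)|\<close>, some
  normalised combination of the \<open>l\<^sub>k\<close> is nonzero and constant on the fibres of \<open>\<phi>\<close>, hence comes from
  a linear form \<open>l\<close> on \<open>\<Delta>\<close> with \<open>l\<^sup>2 \<le> q\<close>, and extremality makes \<open>q\<close> a multiple of \<open>l\<^sup>2\<close>.
  So \<open>m \<le> |V(\<Gamma>)| - |V(\<Delta>)|\<close>, and every restriction of \<open>q\<close> to a face is a sum of \<open>m\<close> squares.
\<close>

section \<open>Simplicial vertices of chordal graphs\<close>

text \<open>Minimality of the number of steps does the work: a repeated vertex, or a forward step of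
  \<open>r\<close> that skips vertices, would splice an initial piece and a final piece into a
  shorter walk.\<close>

lemma shortest_walk:
  assumes "(x, y) \<in> r\<^sup>*"
  obtains n and f :: "nat \<Rightarrow> 'b"
    where "f 0 = x" "f n = y" "\<And>i. i < n \<Longrightarrow> (f i, f (Suc i)) \<in> r"
      and "\<And>i j. i < j \<Longrightarrow> j \<le> n \<Longrightarrow> f i \<noteq> f j"
      and "\<And>i j. i < j \<Longrightarrow> j \<le> n \<Longrightarrow> (f i, f j) \<in> r \<Longrightarrow> j = Suc i"
proof -
  define n where "n = (LEAST n. (x, y) \<in> r ^^ n)"
  have "\<exists>n. (x, y) \<in> r ^^ n" using assms by (simp add: rtrancl_power)
  then have n: "(x, y) \<in> r ^^ n" unfolding n_def by (rule LeastI_ex)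
  have least: "n \<le> k" if "(x, y) \<in> r ^^ k" for k
    unfolding n_def using that by (rule Least_le)
  from n obtain f where f: "f 0 = x" "f n = y" "\<And>i. i < n \<Longrightarrow> (f i, f (Suc i)) \<in> r"
    unfolding relpow_fun_conv by blast
  have init: "(x, f i) \<in> r ^^ i" if "i \<le> n" for i
    unfolding relpow_fun_conv using f that by (intro exI[of _ f]) auto
  have rest: "(f j, y) \<in> r ^^ (n - j)" if "j \<le> n" for j
    unfolding relpow_fun_conv using f that by (intro exI[of _ "\<lambda>i. f (i + j)"]) auto
  show thesis
  proof (rule that[OF f])
    fix i j assume ij: "i < j" "j \<le> n"
    show "f i \<noteq> f j"
    proof
      assume "f i = f j"
      then have "(x, y) \<in> r ^^ (i + (n - j))"
        using init[of i] rest[of j] ij unfolding relpow_add by auto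
      from least[OF this] ij show False by simp
    qed
    assume "(f i, f j) \<in> r"
    then have "(x, f j) \<in> r ^^ Suc i" using init[of i] ij by auto
    then have "(x, y) \<in> r ^^ (Suc i + (n - j))"
      using rest[of j] ij unfolding relpow_add by blast
    from least[OF this] ij show "j = Suc i" by simp
  qed
qed

definition simplicial_vertex :: "'b set set \<Rightarrow> 'b set \<Rightarrow> 'b \<Rightarrow> bool" where
  "simplicial_vertex E W v \<longleftrightarrow>
     v \<in> W \<and> (\<forall>x\<in>W. \<forall>y\<in>W. {v, x} \<in> E \<longrightarrow> {v, y} \<in> E \<longrightarrow> x \<noteq> y \<longrightarrow> {x, y} \<in> E)"

text \<open>If \<open>x\<close> and \<open>y\<close> were not adjacent, a shortest walk between them
  through the connected set \<open>C\<close>, closed up by \<open>v\<close>, would be an induced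
  cycle: \<open>v\<close> has no neighbour in \<open>C\<close>, so its only neighbours on the cycle
  are \<open>x\<close> and \<open>y\<close>.\<close>

lemma component_boundary_clique:
  assumes irr: "\<And>u. {u} \<notin> E"
    and chordal: "\<And>c. induced_cycle W E c \<Longrightarrow> length c < 4"
    and v: "v \<in> W" "v \<notin> C" and C: "C \<subseteq> W" "\<And>a. a \<in> C \<Longrightarrow> {v, a} \<notin> E"
    and conn: "\<And>a b. a \<in> C \<Longrightarrow> b \<in> C \<Longrightarrow> (a, b) \<in> {(a, b). a \<in> C \<and> b \<in> C \<and> {a, b} \<in> E}\<^sup>*"
    and x: "x \<in> W" "{v, x} \<in> E" "a \<in> C" "{x, a} \<in> E"
    and y: "y \<in> W" "{v, y} \<in> E" "b \<in> C" "{y, b} \<in> E"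
    and ne: "x \<noteq> y"
  shows "{x, y} \<in> E"
proof (rule ccontr)
  assume xy: "{x, y} \<notin> E"
  let ?D = "insert x (insert y C)"
  let ?r = "{(a, b). a \<in> ?D \<and> b \<in> ?D \<and> {a, b} \<in> E}"
  have "(x, a) \<in> ?r" "(b, y) \<in> ?r" using x y by (auto simp: insert_commute)
  moreover have "(a, b) \<in> ?r\<^sup>*"
    by (rule subsetD[OF rtrancl_mono conn[OF x(3) y(3)]]) auto
  ultimately have "(x, y) \<in> ?r\<^sup>*" by (meson converse_rtrancl_into_rtrancl rtrancl_into_rtrancl)
  then obtain n f where f: "f 0 = x" "f n = y" "\<And>i. i < n \<Longrightarrow> (f i, f (Suc i)) \<in> ?r"
      and dist: "\<And>i j. i < j \<Longrightarrow> j \<le> n \<Longrightarrow> f i \<noteq> f j"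
      and ind: "\<And>i j. i < j \<Longrightarrow> j \<le> n \<Longrightarrow> (f i, f j) \<in> ?r \<Longrightarrow> j = Suc i"
    by (rule shortest_walk) blast
  \<comment> \<open>This makes the cycle, which has \<open>n + 2\<close> vertices, long enough to
    contradict chordality.\<close>
  have n: "2 \<le> n"
  proof (rule ccontr)
    assume "\<not> 2 \<le> n"
    then have "n = 0 \<or> n = 1" by auto
    then show False using f f(3)[of 0] ne xy by auto
  qed
  have D: "f i \<in> ?D" if "i \<le> n" for i
    using f(1,2) f(3)[of i] that by (cases "i = n") auto
  have inC: "f i \<in> C" if "0 < i" "i < n" for i
    using D[of i] dist[of 0 i] dist[of i n] f that by auto
  have adj: "{f i, f j} \<in> E \<longleftrightarrow> j = Suc i \<or> i = Suc j" if "i \<le> n" "j \<le> n" for i j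
  proof
    assume e: "{f i, f j} \<in> E"
    then have r: "(f i, f j) \<in> ?r" "(f j, f i) \<in> ?r" using D that by (auto simp: insert_commute)
    consider "i < j" | "j < i" | "i = j" by linarith
    then show "j = Suc i \<or> i = Suc j"
      using ind r that e irr by cases auto
  next
    assume "j = Suc i \<or> i = Suc j"
    then show "{f i, f j} \<in> E" using f(3)[of i] f(3)[of j] that by (auto simp: insert_commute)
  qed
  have adjv: "{v, f i} \<in> E \<longleftrightarrow> i = 0 \<or> i = n" if "i \<le> n" for i
    using f x y C(2)[OF inC[of i]] that by (cases "i = 0 \<or> i = n") auto
  have vf: "v \<noteq> f i" if "i \<le> n" for i
    using D[OF that] v x(2) y(2) irr[of v] by auto
  \<comment> \<open>Putting \<open>v\<close> in front shifts indices by one: position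
    \<open>Suc i\<close> holds \<open>f i\<close>, and position \<open>Suc n\<close> is followed by
    \<open>v\<close> again.\<close>
  define c where "c = v # map f [0..<Suc n]"
  have len: "length c = n + 2" by (simp add: c_def)
  have c0: "c ! 0 = v" by (simp add: c_def)
  have cS: "c ! Suc i = f i" if "i \<le> n" for i
    using that by (simp add: c_def del: upt_Suc)
  have "induced_cycle W E c"
    unfolding induced_cycle_def
  proof (intro conjI allI impI)
    show "3 \<le> length c" using len n by simp
    have "inj_on f {0..<Suc n}"
      by (rule linorder_inj_onI) (use dist in auto)
    moreover have "v \<notin> f ` {0..<Suc n}" using vf by (auto simp: image_iff)
    ultimately show "distinct c" by (simp add: c_def distinct_map del: upt_Suc)
    have "f i \<in> W" if "i \<le> n" for i using D[OF that] C(1) x(1) y(1) by auto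
    then show "set c \<subseteq> W" using v(1) by (auto simp: c_def simp del: upt_Suc)
    fix i j assume ij: "i < length c" "j < length c"
    have m: "(k + 1) mod length c = (if k = Suc n then 0 else Suc k)" if "k < length c" for k
      using that len by auto
    show "({c ! i, c ! j} \<in> E) = (j = (i + 1) mod length c \<or> i = (j + 1) mod length c)"
      unfolding m[OF ij(1)] m[OF ij(2)]
      using ij irr n
      by (cases i; cases j) (auto simp: c0 cS adj adjv len insert_commute[of _ v])
  qed
  from chordal[OF this] len n show False by simp
qed

text \<open>
  The second conjunct, with the vertex away from a prescribed \<open>v\<close>, is what makes the induction
  work: the simplicial vertex of \<open>C \<union> S\<close> must lie in the component \<open>C\<close>, not in its boundary \<open>S\<close>.
\<close>

lemma simplicial_vertex_exists:
  assumes "finite W" and irr: "\<And>u. {u} \<notin> E"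
    and "\<And>c. induced_cycle W E c \<Longrightarrow> length c < 4"
  shows "(W \<noteq> {} \<longrightarrow> (\<exists>w. simplicial_vertex E W w)) \<and>
    (\<forall>v\<in>W. (\<exists>u\<in>W. u \<noteq> v \<and> {v, u} \<notin> E) \<longrightarrow>
       (\<exists>w. simplicial_vertex E W w \<and> w \<noteq> v \<and> {v, w} \<notin> E))"
  using assms(1,3)
proof (induction W rule: finite_psubset_induct)
  case (psubset W)
  have hered: "length c < 4" if "induced_cycle U E c" "U \<subseteq> W" for U c
    using that psubset.prems[of c] unfolding induced_cycle_def by auto
  have far: "\<exists>w. simplicial_vertex E W w \<and> w \<noteq> v \<and> {v, w} \<notin> E"
    if v: "v \<in> W" and u: "u \<in> W" "u \<noteq> v" "{v, u} \<notin> E" for v u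
  proof -
    \<comment> \<open>\<open>A\<close> consists of the non-neighbours of \<open>v\<close>,
      \<open>C\<close> is the connected component of \<open>u\<close> in the graph induced on
      \<open>A\<close>, and \<open>S\<close> is the boundary of \<open>C\<close>, which consists of
      neighbours of \<open>v\<close>.\<close>
    define A where "A = {a \<in> W. a \<noteq> v \<and> {v, a} \<notin> E}"
    define r where "r = {(a, b). a \<in> A \<and> b \<in> A \<and> {a, b} \<in> E}"
    define C where "C = {a. (u, a) \<in> r\<^sup>*}"
    define S where "S = {x \<in> W. {v, x} \<in> E \<and> (\<exists>a\<in>C. {x, a} \<in> E)}"
    have uA: "u \<in> A" using u by (simp add: A_def)
    have CA: "C \<subseteq> A"
    proof
      fix a assume "a \<in> C"
      then have "(u, a) \<in> r\<^sup>*" by (simp add: C_def)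
      then show "a \<in> A" by (induction rule: rtrancl_induct) (use uA r_def in auto)
    qed
    have uC: "u \<in> C" by (simp add: C_def)
    have step: "b \<in> C" if "a \<in> C" "b \<in> A" "{a, b} \<in> E" for a b
    proof -
      have "(a, b) \<in> r" using that CA by (auto simp: r_def)
      with that(1) show ?thesis unfolding C_def by (auto intro: rtrancl_into_rtrancl)
    qed
    let ?rC = "{(a, b). a \<in> C \<and> b \<in> C \<and> {a, b} \<in> E}"
    have from_u: "(u, a) \<in> ?rC\<^sup>*" if "a \<in> C" for a
    proof -
      have "(u, a) \<in> r\<^sup>*" using that by (simp add: C_def)
      then show ?thesis
      proof (induction rule: rtrancl_induct)
        case (step a b)
        have "a \<in> C" "b \<in> C" using step.hyps by (auto simp: C_def)
        then have "(a, b) \<in> ?rC" using step.hyps by (auto simp: r_def)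
        with step.IH show ?case by (rule rtrancl_into_rtrancl)
      qed simp
    qed
    have "sym ?rC" by (auto simp: sym_def insert_commute)
    then have conn: "(a, b) \<in> ?rC\<^sup>*" if "a \<in> C" "b \<in> C" for a b
      using from_u[OF that(1)] from_u[OF that(2)] sym_rtrancl[of ?rC]
      by (meson rtrancl_trans symD)
    have S_clique: "{x, y} \<in> E" if xy: "x \<in> S" "y \<in> S" "x \<noteq> y" for x y
    proof -
      obtain a b where ab: "a \<in> C" "{x, a} \<in> E" "b \<in> C" "{y, b} \<in> E"
        using xy by (auto simp: S_def)
      show ?thesis
      proof (rule component_boundary_clique[OF irr psubset.prems v _ _ _ conn])
        show "v \<notin> C" "C \<subseteq> W" using CA by (auto simp: A_def)
        show "{v, a} \<notin> E" if "a \<in> C" for a using that CA by (auto simp: A_def)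
        show "x \<in> W" "{v, x} \<in> E" "y \<in> W" "{v, y} \<in> E" using xy by (auto simp: S_def)
      qed (use ab xy in auto)
    qed
    \<comment> \<open>A neighbour of \<open>C\<close> that is not adjacent to \<open>v\<close> lies
      in \<open>A\<close>, hence in the same component. So \<open>C \<union> S\<close> contains all
      neighbours of \<open>C\<close>, and simpliciality of a vertex of \<open>C\<close> passes from
      \<open>C \<union> S\<close> to \<open>W\<close>.\<close>
    have nbr: "y \<in> C \<union> S" if "a \<in> C" "y \<in> W" "{a, y} \<in> E" for a y
    proof (cases "{v, y} \<in> E")
      case True
      with that show ?thesis by (auto simp: S_def insert_commute)
    next
      case False
      have "y \<noteq> v" using that CA by (auto simp: A_def insert_commute)
      with False that step show ?thesis by (auto simp: A_def)
    qed
    have CW: "C \<subseteq> W" "v \<notin> C" using CA by (auto simp: A_def)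
    have SW: "S \<subseteq> W" "v \<notin> S" using irr by (auto simp: S_def)
    have lift: "simplicial_vertex E W w" if "simplicial_vertex E (C \<union> S) w" "w \<in> C" for w
      using that nbr CW SW unfolding simplicial_vertex_def by blast
    have "\<exists>w\<in>C. simplicial_vertex E (C \<union> S) w"
    proof (cases "\<exists>s\<in>S. \<exists>a\<in>C. {s, a} \<notin> E")
      case True
      \<comment> \<open>Induction is applied away from \<open>s\<close>. The vertex found is not
        adjacent to \<open>s\<close>, while \<open>S\<close> is a clique, so it cannot lie in
        \<open>S\<close>.\<close>
      then obtain s a where sa: "s \<in> S" "a \<in> C" "{s, a} \<notin> E" by blast
      have "a \<noteq> s" using sa CA by (auto simp: S_def A_def)
      have "C \<union> S \<subset> W" using CW SW v by blast
      from psubset.IH[OF this] hered[of "C \<union> S"] \<open>C \<union> S \<subset> W\<close> sa \<open>a \<noteq> s\<close>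
      obtain w where w: "simplicial_vertex E (C \<union> S) w" "w \<noteq> s" "{s, w} \<notin> E"
        by (metis UnI1 UnI2 psubset_imp_subset)
      then have "w \<in> C" using S_clique sa(1) unfolding simplicial_vertex_def by blast
      with w show ?thesis by blast
    next
      case False
      \<comment> \<open>Now all of \<open>S\<close> is joined to all of \<open>C\<close>, so a
        simplicial vertex of \<open>C\<close> stays simplicial after the clique \<open>S\<close> is
        added.\<close>
      have "C \<subset> W" using CW v by blast
      from psubset.IH[OF this] hered[of C] \<open>C \<subset> W\<close> uC
      obtain w where w: "simplicial_vertex E C w" by blast
      have SC: "{s, a} \<in> E" "{a, s} \<in> E" if "s \<in> S" "a \<in> C" for s a
        using that False by (auto simp: insert_commute)
      have "{x, y} \<in> E" if "x \<in> C \<union> S" "y \<in> C \<union> S" "{w, x} \<in> E" "{w, y} \<in> E" "x \<noteq> y" for x y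
        using that w SC S_clique unfolding simplicial_vertex_def by blast
      with w show ?thesis unfolding simplicial_vertex_def by blast
    qed
    then show ?thesis using lift CA unfolding A_def by blast
  qed
  have "\<exists>w. simplicial_vertex E W w" if "W \<noteq> {}"
  proof -
    from that obtain v where v: "v \<in> W" by blast
    show ?thesis
    proof (cases "\<exists>u\<in>W. u \<noteq> v \<and> {v, u} \<notin> E")
      case True
      then show ?thesis using far v by blast
    next
      \<comment> \<open>Here \<open>v\<close> is joined to every other vertex, so adding it back to
        \<open>W - {v}\<close> preserves simpliciality.\<close>
      case False
      show ?thesis
      proof (cases "W = {v}")
        case True
        then show ?thesis unfolding simplicial_vertex_def by auto
      next
        case ne: False
        have "W - {v} \<subset> W" using v by blast
        from psubset.IH[OF this] hered[of "W - {v}"] ne v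
        obtain w where "simplicial_vertex E (W - {v}) w" by blast
        moreover have "{v, x} \<in> E" "{x, v} \<in> E" if "x \<in> W" "x \<noteq> v" for x
          using False that by (auto simp: insert_commute)
        ultimately have "simplicial_vertex E W w"
          unfolding simplicial_vertex_def by blast
        then show ?thesis by blast
      qed
    qed
  qed
  with far show ?case by blast
qed

section \<open>Gram representations\<close>

text \<open>Gaussian elimination: one equation is used to eliminate one unknown \<open>w\<close>,
  which lowers both cardinalities by one.\<close>

lemma homogeneous_system_nontrivial:
  fixes c :: "'e \<Rightarrow> 'u \<Rightarrow> real"
  assumes "finite E" "finite U" "card E < card U"
  obtains a where "\<exists>u\<in>U. a u \<noteq> 0" "\<And>e. e \<in> E \<Longrightarrow> (\<Sum>u\<in>U. c e u * a u) = 0"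
proof -
  have "\<exists>a. (\<exists>u\<in>U. a u \<noteq> 0) \<and> (\<forall>e\<in>E. (\<Sum>u\<in>U. c e u * a u) = 0)"
    using assms
  proof (induction E arbitrary: U c)
    case empty
    then have "U \<noteq> {}" by auto
    then show ?case by (intro exI[of _ "\<lambda>_. 1"]) auto
  next
    case (insert e E)
    show ?case
    proof (cases "\<forall>u\<in>U. c e u = 0")
      case True
      moreover have "card E < card U" using insert.hyps insert.prems by simp
      ultimately show ?thesis using insert.IH[of U c] insert.prems by auto
    next
      case False
      then obtain w where w: "w \<in> U" "c e w \<noteq> 0" by blast
      \<comment> \<open>\<open>?c\<close> holds the coefficients left after equation
        \<open>e\<close> has been solved for \<open>w\<close> and substituted; \<open>t\<close>
        below is the resulting value of \<open>w\<close>.\<close>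
      let ?U = "U - {w}"
      let ?c = "\<lambda>d u. c d u - c d w * c e u / c e w"
      have "card E < card ?U" using insert.hyps insert.prems w by simp
      then obtain a where a: "\<exists>u\<in>?U. a u \<noteq> 0" "\<forall>d\<in>E. (\<Sum>u\<in>?U. ?c d u * a u) = 0"
        using insert.IH[of ?U ?c] insert.prems by blast
      define t where "t = - (\<Sum>u\<in>?U. c e u * a u) / c e w"
      have split: "(\<Sum>u\<in>U. c d u * (a(w := t)) u) = c d w * t + (\<Sum>u\<in>?U. c d u * a u)" for d
      proof -
        have "(\<Sum>u\<in>?U. c d u * (a(w := t)) u) = (\<Sum>u\<in>?U. c d u * a u)"
          by (rule sum.cong) auto
        then show ?thesis using sum.remove[OF insert.prems(1) w(1), of "\<lambda>u. c d u * (a(w := t)) u"]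
          by simp
      qed
      have "(\<Sum>u\<in>U. c d u * (a(w := t)) u) = 0" if "d \<in> insert e E" for d
      proof (cases "d = e")
        case True
        then show ?thesis unfolding split using w by (simp add: t_def)
      next
        case False
        then have "0 = (\<Sum>u\<in>?U. ?c d u * a u)" using a that by simp
        also have "\<dots> = (\<Sum>u\<in>?U. c d u * a u) - c d w / c e w * (\<Sum>u\<in>?U. c e u * a u)"
          by (simp add: algebra_simps sum_subtractf sum_distrib_left)
        also have "\<dots> = c d w * t + (\<Sum>u\<in>?U. c d u * a u)" by (simp add: t_def)
        finally show ?thesis unfolding split by simp
      qed
      moreover have "\<exists>u\<in>U. (a(w := t)) u \<noteq> 0" using a(1) by auto
      ultimately show ?thesis by blast
    qed
  qed
  then show ?thesis using that by blast
qed

section \<open>Positive semidefinite matrices on finite index sets\<close>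

definition quad :: "('b \<Rightarrow> 'b \<Rightarrow> real) \<Rightarrow> 'b set \<Rightarrow> ('b \<Rightarrow> real) \<Rightarrow> real" where
  "quad B S y = (\<Sum>i\<in>S. \<Sum>j\<in>S. B i j * y i * y j)"

lemma quad_insert:
  assumes "finite S" "k \<notin> S" "\<And>i j. B i j = B j i"
  shows "quad B (insert k S) y = quad B S y + 2 * y k * (\<Sum>j\<in>S. B k j * y j) + B k k * (y k)\<^sup>2"
proof -
  have "(\<Sum>i\<in>S. B i k * y i * y k) = y k * (\<Sum>j\<in>S. B k j * y j)"
    unfolding sum_distrib_left by (rule sum.cong) (use assms(3) in \<open>auto simp: mult_ac\<close>)
  moreover have "(\<Sum>j\<in>S. B k j * y k * y j) = y k * (\<Sum>j\<in>S. B k j * y j)"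
    unfolding sum_distrib_left by (rule sum.cong) (auto simp: mult_ac)
  ultimately show ?thesis
    using assms(1,2) by (simp add: quad_def sum.distrib power2_eq_square)
qed

lemma quad_cong: "(\<And>i. i \<in> S \<Longrightarrow> y i = z i) \<Longrightarrow> quad B S y = quad B S z"
  unfolding quad_def by (intro sum.cong) auto

text \<open>On the vectors with entry 1 at \<open>i\<close> and \<open>t\<close> at \<open>k\<close>
  the form equals \<open>B i i + 2 * t * B k i\<close>. This is affine in \<open>t\<close>, so a
  nonzero slope would produce the value -1.\<close>

lemma psd_isotropic:
  assumes sym: "\<And>i j. B i j = B j i" and fin: "finite S"
    and psd: "\<And>y. 0 \<le> quad B S y" and k: "k \<in> S" "B k k = 0" and i: "i \<in> S"
  shows "B k i = 0"
proof (rule ccontr)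
  assume ne: "B k i \<noteq> 0"
  then have ik: "i \<noteq> k" using k by auto
  define t where "t = - (B i i + 1) / (2 * B k i)"
  define y where "y = (\<lambda>j. if j = i then 1 else if j = k then t else 0)"
  have S: "S = insert k (insert i (S - {i, k}))" using i k by auto
  have z: "quad B (S - {i, k}) y = 0" "(\<Sum>j\<in>S - {i, k}. B l j * y j) = 0" for l
    unfolding quad_def by (auto intro!: sum.neutral simp: y_def)
  have ins: "quad B (insert k (insert i (S - {i, k}))) y
      = quad B (insert i (S - {i, k})) y
        + 2 * y k * (\<Sum>j\<in>insert i (S - {i, k}). B k j * y j) + B k k * (y k)\<^sup>2"
    "quad B (insert i (S - {i, k})) y = quad B (S - {i, k}) y
        + 2 * y i * (\<Sum>j\<in>S - {i, k}. B i j * y j) + B i i * (y i)\<^sup>2"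
    using fin ik by (intro quad_insert sym; auto)+
  have "quad B S y = quad B (insert k (insert i (S - {i, k}))) y"
    by (rule arg_cong[OF S, of "\<lambda>X. quad B X y"])
  also have "\<dots> = B i i + 2 * t * B k i"
    unfolding ins using fin ik k(2) by (simp add: z) (simp add: y_def)
  also have "\<dots> = -1" using ne by (simp add: t_def field_simps)
  finally show False using psd[of y] by simp
qed

text \<open>The column of \<open>v\<close> lies in the range of the block on \<open>K\<close>. This
  is proved by eliminating one index \<open>k\<close> at a time through Schur complements; a zero
  pivot is harmless because its whole row vanishes.\<close>

lemma psd_column_in_range:
  assumes "finite K" "v \<notin> K" "\<And>i j. B i j = B j i" "\<And>y. 0 \<le> quad B (insert v K) y"
  obtains c where "\<And>i. i \<in> K \<Longrightarrow> B i v = (\<Sum>j\<in>K. B i j * c j)"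
proof -
  have "\<exists>c. \<forall>i\<in>K. B i v = (\<Sum>j\<in>K. B i j * c j)"
    using assms
  proof (induction K arbitrary: B)
    case (insert k K)
    let ?S = "insert v K"
    have k: "k \<notin> ?S" "finite ?S" "insert v (insert k K) = insert k ?S"
      using insert.hyps insert.prems by auto
    have vK: "v \<notin> K" using insert.prems(1) by simp
    have sym: "B i j = B j i" for i j by (rule insert.prems)
    have ins: "quad B (insert k ?S) y
        = quad B ?S y + 2 * y k * (\<Sum>j\<in>?S. B k j * y j) + B k k * (y k)\<^sup>2" for y
      by (rule quad_insert[OF k(2,1) sym])
    have psd: "0 \<le> quad B (insert k ?S) y" for y using insert.prems(3) k by metis
    show ?case
    proof (cases "B k k = 0")
      case True
      have z: "B k i = 0" if "i \<in> insert k ?S" for i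
        by (rule psd_isotropic[OF sym _ psd]) (use True that k in auto)
      have "0 \<le> quad B ?S y" for y
      proof -
        have "quad B ?S (y(k := 0)) = quad B ?S y" using k by (intro quad_cong) auto
        with psd[of "y(k := 0)"] ins[of "y(k := 0)"] show ?thesis by simp
      qed
      from insert.IH[OF vK sym this]
      obtain c where c: "\<forall>i\<in>K. B i v = (\<Sum>j\<in>K. B i j * c j)" by blast
      have "B i v = (\<Sum>j\<in>insert k K. B i j * (c(k := 0)) j)" if "i \<in> insert k K" for i
      proof -
        have "(\<Sum>j\<in>K. B i j * (c(k := 0)) j) = (\<Sum>j\<in>K. B i j * c j)"
          using insert.hyps by (intro sum.cong) auto
        then show ?thesis using insert.hyps c z that by auto
      qed
      then show ?thesis by blast
    next
      case False
      have pos: "0 < B k k"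
      proof -
        have "quad B ?S (\<lambda>i. if i = k then 1 else 0) = 0"
          unfolding quad_def using k by (intro sum.neutral ballI) auto
        moreover have "(\<Sum>j\<in>?S. B k j * (if j = k then 1 else 0)) = 0"
          using k by (intro sum.neutral ballI) auto
        ultimately have "quad B (insert k ?S) (\<lambda>i. if i = k then 1 else 0) = B k k"
          using ins[of "\<lambda>i. if i = k then 1 else 0"] by simp
        with psd[of "\<lambda>i. if i = k then 1 else 0"] False show ?thesis by simp
      qed
      \<comment> \<open>The Schur complement of the pivot \<open>B k k\<close>.\<close>
      define B' where "B' = (\<lambda>i j. B i j - B k i * B k j / B k k)"
      have symB': "B' i j = B' j i" for i j
        unfolding B'_def using sym[of i j] by (simp add: mult.commute)
      have "0 \<le> quad B' ?S y" for y
      proof -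
        let ?s = "\<Sum>j\<in>?S. B k j * y j"
        \<comment> \<open>This entry at \<open>k\<close> minimises the form when the other entries
          are fixed, and the minimum is the Schur complement form at \<open>y\<close>.\<close>
        let ?z = "y(k := - ?s / B k k)"
        have s: "(\<Sum>j\<in>?S. B k j * ?z j) = ?s" using k(1) by (intro sum.cong) auto
        have q: "quad B ?S ?z = quad B ?S y" using k by (intro quad_cong) auto
        have "quad B' ?S y = quad B ?S y - (\<Sum>i\<in>?S. \<Sum>j\<in>?S. B k i * B k j / B k k * y i * y j)"
          unfolding quad_def B'_def by (simp add: left_diff_distrib sum_subtractf)
        also have "(\<Sum>i\<in>?S. \<Sum>j\<in>?S. B k i * B k j / B k k * y i * y j) = ?s * ?s / B k k"
          unfolding sum_product sum_divide_distrib
          by (intro sum.cong refl) (simp add: mult_ac)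
        also have "quad B ?S y - ?s * ?s / B k k = quad B (insert k ?S) ?z"
          unfolding ins s q using pos
          by (simp add: field_simps power2_eq_square)
        finally show ?thesis using psd by simp
      qed
      from insert.IH[OF vK symB' this]
      obtain c where c: "\<forall>i\<in>K. B' i v = (\<Sum>j\<in>K. B' i j * c j)" by blast
      \<comment> \<open>Back substitution: \<open>t\<close> solves row \<open>k\<close>, and the
        rows of the Schur complement then turn into the rows of \<open>B\<close>.\<close>
      define t where "t = (B k v - (\<Sum>j\<in>K. B k j * c j)) / B k k"
      have "B i v = (\<Sum>j\<in>insert k K. B i j * (c(k := t)) j)" if i: "i \<in> insert k K" for i
      proof -
        have "(\<Sum>j\<in>insert k K. B i j * (c(k := t)) j) = B i k * t + (\<Sum>j\<in>K. B i j * (c(k := t)) j)"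
          using insert.hyps by simp
        also have "(\<Sum>j\<in>K. B i j * (c(k := t)) j) = (\<Sum>j\<in>K. B i j * c j)"
          using insert.hyps by (intro sum.cong) auto
        finally have e: "(\<Sum>j\<in>insert k K. B i j * (c(k := t)) j) = B i k * t + (\<Sum>j\<in>K. B i j * c j)" .
        show ?thesis
        proof (cases "i = k")
          case True
          then show ?thesis unfolding e using pos by (simp add: t_def)
        next
          case False
          with i c have "B i v - B k i * B k v / B k k
              = (\<Sum>j\<in>K. (B i j - B k i * B k j / B k k) * c j)"
            by (simp add: B'_def)
          also have "\<dots> = (\<Sum>j\<in>K. B i j * c j) - B k i / B k k * (\<Sum>j\<in>K. B k j * c j)"
            by (simp add: algebra_simps sum_subtractf sum_distrib_left)
          finally show ?thesis unfolding e sym[of i k] using pos by (simp add: t_def field_simps)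
        qed
      qed
      then show ?thesis by blast
    qed
  qed simp
  then show ?thesis using that by blast
qed

section \<open>Shortening Gram representations\<close>

text \<open>A coordinate of the Gram vectors that is the combination of the others with coefficients
  \<open>b\<close> can be absorbed: adding \<open>d j\<close> times it to each remaining coordinate
  \<open>j\<close> makes up for its contribution to all inner products.\<close>

lemma gram_drop_dependent:
  fixes b :: "'k \<Rightarrow> real"
  obtains d where "\<And>u w. (\<Sum>j\<in>U. (u j + d j * (\<Sum>i\<in>U. b i * u i)) * (w j + d j * (\<Sum>i\<in>U. b i * w i)))
      = (\<Sum>j\<in>U. u j * w j) + (\<Sum>i\<in>U. b i * u i) * (\<Sum>i\<in>U. b i * w i)"
proof -
  define \<beta> where "\<beta> = (\<Sum>j\<in>U. (b j)\<^sup>2)"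
  \<comment> \<open>Chosen so that \<open>I + t b b\<^sup>T\<close> is the square root of \<open>I + b b\<^sup>T\<close>.\<close>
  define t where "t = 1 / (1 + sqrt (1 + \<beta>))"
  have \<beta>: "0 \<le> \<beta>" by (simp add: \<beta>_def sum_nonneg)
  have t: "2 * t + t\<^sup>2 * \<beta> = 1"
  proof -
    define r where "r = sqrt (1 + \<beta>)"
    have "\<beta> = r\<^sup>2 - 1" "0 \<le> r" using \<beta> by (simp_all add: r_def)
    then show ?thesis unfolding t_def r_def[symmetric]
      by (simp add: power2_eq_square divide_simps) (simp add: algebra_simps)
  qed
  have "(\<Sum>j\<in>U. (u j + t * b j * (\<Sum>i\<in>U. b i * u i)) * (w j + t * b j * (\<Sum>i\<in>U. b i * w i)))
      = (\<Sum>j\<in>U. u j * w j) + (\<Sum>i\<in>U. b i * u i) * (\<Sum>i\<in>U. b i * w i)" for u w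
  proof -
    define L where "L = (\<Sum>i\<in>U. b i * u i)"
    define M where "M = (\<Sum>i\<in>U. b i * w i)"
    have "(\<Sum>j\<in>U. (u j + t * b j * L) * (w j + t * b j * M))
        = (\<Sum>j\<in>U. u j * w j + t * M * (b j * u j) + t * L * (b j * w j) + t\<^sup>2 * L * M * (b j)\<^sup>2)"
      by (intro sum.cong) (auto simp: power2_eq_square algebra_simps)
    also have "\<dots> = (\<Sum>j\<in>U. u j * w j) + t * M * L + t * L * M + t\<^sup>2 * L * M * \<beta>"
      by (simp add: sum.distrib sum_distrib_left[symmetric] L_def M_def \<beta>_def)
    also have "\<dots> = (\<Sum>j\<in>U. u j * w j) + L * M * (2 * t + t\<^sup>2 * \<beta>)"
      by (simp add: algebra_simps)
    finally show ?thesis using t by (simp add: L_def M_def)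
  qed
  then show ?thesis using that[of "\<lambda>j. t * b j"] by simp
qed

lemma gram_reduction:
  fixes B :: "'b \<Rightarrow> 'b \<Rightarrow> real" and g :: "'k \<Rightarrow> 'b \<Rightarrow> real"
  assumes fin: "finite U" "finite Z" and P: "P \<subseteq> W \<times> W"
    and gram: "\<And>i j. (i, j) \<in> P \<Longrightarrow> B i j = (\<Sum>k\<in>U. g k i * g k j)"
    and vanish: "\<And>(U :: 'k set) g a. finite U \<Longrightarrow> (\<And>i j. (i, j) \<in> P \<Longrightarrow> B i j = (\<Sum>k\<in>U. g k i * g k j)) \<Longrightarrow>
      (\<And>i. i \<in> Z \<Longrightarrow> (\<Sum>k\<in>U. a k * g k i) = (\<Sum>k\<in>U. a k * g k (s i))) \<Longrightarrow>
      \<forall>i\<in>W. (\<Sum>k\<in>U. a k * g k i) = 0"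
  shows "\<exists>U' (g' :: 'k \<Rightarrow> 'b \<Rightarrow> real). finite U' \<and> card U' \<le> card Z \<and>
    (\<forall>i j. (i, j) \<in> P \<longrightarrow> B i j = (\<Sum>k\<in>U'. g' k i * g' k j))"
  using fin(1) gram
proof (induction U arbitrary: g rule: finite_psubset_induct)
  case (psubset U)
  show ?case
  proof (cases "card U \<le> card Z")
    case True
    then show ?thesis using psubset.hyps psubset.prems by blast
  next
    case False
    then obtain a where a: "\<exists>k\<in>U. a k \<noteq> 0"
      "\<And>i. i \<in> Z \<Longrightarrow> (\<Sum>k\<in>U. (g k i - g k (s i)) * a k) = 0"
      using homogeneous_system_nontrivial[OF fin(2) psubset.hyps,
          where c = "\<lambda>i k. g k i - g k (s i)"] by auto
    have "(\<Sum>k\<in>U. a k * g k i) = (\<Sum>k\<in>U. a k * g k (s i))" if "i \<in> Z" for i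
      using a(2)[OF that] by (simp add: algebra_simps sum_subtractf)
    from vanish[OF psubset.hyps psubset.prems this]
    have zero: "(\<Sum>k\<in>U. a k * g k i) = 0" if "i \<in> W" for i using that by blast
    obtain l where l: "l \<in> U" "a l \<noteq> 0" using a(1) by blast
    let ?U = "U - {l}"
    define b where "b = (\<lambda>k. - a k / a l)"
    have gl: "g l i = (\<Sum>k\<in>?U. b k * g k i)" if "i \<in> W" for i
    proof -
      have "a l * g l i + (\<Sum>k\<in>?U. a k * g k i) = 0"
        using zero[OF that] sum.remove[OF psubset.hyps l(1), of "\<lambda>k. a k * g k i"] by simp
      moreover have "(\<Sum>k\<in>?U. b k * g k i) = - (\<Sum>k\<in>?U. a k * g k i) / a l"
        unfolding b_def sum_divide_distrib sum_negf[symmetric] by simp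
      ultimately have "a l * g l i = a l * (\<Sum>k\<in>?U. b k * g k i)" using l(2) by simp
      then show ?thesis using l(2) by simp
    qed
    obtain d where d: "\<And>u w. (\<Sum>j\<in>?U. (u j + d j * (\<Sum>i\<in>?U. b i * u i)) * (w j + d j * (\<Sum>i\<in>?U. b i * w i)))
        = (\<Sum>j\<in>?U. u j * w j) + (\<Sum>i\<in>?U. b i * u i) * (\<Sum>i\<in>?U. b i * w i)"
      using gram_drop_dependent[where U = ?U and b = b] by blast
    have "B i j = (\<Sum>k\<in>?U. (g k i + d k * g l i) * (g k j + d k * g l j))" if "(i, j) \<in> P" for i j
    proof -
      have W: "i \<in> W" "j \<in> W" using that P by auto
      have "B i j = g l i * g l j + (\<Sum>k\<in>?U. g k i * g k j)"
        using psubset.prems[OF that] sum.remove[OF psubset.hyps l(1), of "\<lambda>k. g k i * g k j"] by simp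
      then show ?thesis
        using d[of "\<lambda>k. g k i" "\<lambda>k. g k j"] gl[OF W(1)] gl[OF W(2)] by simp
    qed
    moreover have "?U \<subset> U" using l by blast
    ultimately show ?thesis by (rule psubset.IH[rotated])
  qed
qed

text \<open>Cauchy-Schwarz for a unit vector \<open>a\<close>: the difference of the two sides is
  the squared length of \<open>u\<close> minus its projection onto \<open>a\<close>.\<close>

lemma sum_mult_squared_le:
  fixes a :: "'k \<Rightarrow> real"
  assumes "(\<Sum>k\<in>U. (a k)\<^sup>2) = 1"
  shows "(\<Sum>k\<in>U. a k * u k)\<^sup>2 \<le> (\<Sum>k\<in>U. (u k)\<^sup>2)"
proof -
  define s where "s = (\<Sum>k\<in>U. a k * u k)"
  have "0 \<le> (\<Sum>k\<in>U. (u k - a k * s)\<^sup>2)" by (rule sum_nonneg) simp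
  also have "\<dots> = (\<Sum>k\<in>U. (u k)\<^sup>2 - 2 * s * (a k * u k) + s\<^sup>2 * (a k)\<^sup>2)"
    by (intro sum.cong) (auto simp: power2_eq_square algebra_simps)
  also have "\<dots> = (\<Sum>k\<in>U. (u k)\<^sup>2) - s\<^sup>2"
    by (simp add: sum.distrib sum_subtractf sum_distrib_left[symmetric] assms s_def[symmetric])
      (simp add: power2_eq_square)
  finally show ?thesis by (simp add: s_def)
qed

text \<open>Positive semidefinite completion along a perfect elimination order. After a simplicial
  vertex \<open>v\<close> is removed, its neighbours \<open>K\<close> already have Gram vectors; the
  vector of \<open>v\<close> is a combination of these plus a component in one new
  direction.\<close>

lemma chordal_psd_completion:
  fixes B :: "'b \<Rightarrow> 'b \<Rightarrow> real"
  assumes "finite W" and irr: "\<And>u. {u} \<notin> E"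
    and "\<And>c. induced_cycle W E c \<Longrightarrow> length c < 4"
    and sym: "\<And>i j. B i j = B j i"
    and "\<And>K y. K \<in> clique_complex W E \<Longrightarrow> 0 \<le> quad B K y"
  shows "\<exists>(m :: nat) g. \<forall>i\<in>W. \<forall>j\<in>W. i = j \<or> {i, j} \<in> E \<longrightarrow>
    B i j = (\<Sum>k<m. g k i * g k j)"
  using assms(1,3,5)
proof (induction W rule: finite_psubset_induct)
  case (psubset W)
  show ?case
  proof (cases "W = {}")
    case False
    then obtain v where v: "simplicial_vertex E W v"
      using simplicial_vertex_exists[OF psubset.hyps irr psubset.prems(1)] by blast
    let ?W = "W - {v}"
    define K where "K = {i \<in> W. {v, i} \<in> E}"
    have vW: "v \<in> W" using v by (simp add: simplicial_vertex_def)
    have vK: "v \<notin> K" using irr by (simp add: K_def)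
    have KW: "K \<subseteq> ?W" using vK by (auto simp: K_def)
    have finK: "finite K" using KW psubset.hyps by (meson finite_Diff finite_subset)
    have adjK: "i = j \<or> {i, j} \<in> E" if "i \<in> K" "j \<in> K" for i j
      using v that by (auto simp: K_def simplicial_vertex_def)
    have clq: "insert v K \<in> clique_complex W E"
      using adjK vW KW by (auto simp: clique_complex_def K_def insert_commute)
    have psdK: "0 \<le> quad B (insert v K) y" for y
      using psubset.prems(2)[OF clq] .
    obtain c where c: "\<And>i. i \<in> K \<Longrightarrow> B i v = (\<Sum>j\<in>K. B i j * c j)"
      using psd_column_in_range[OF finK vK sym psdK] by blast
    have sub: "?W \<subset> W" using vW by blast
    have ind: "length d < 4" if "induced_cycle ?W E d" for d
      using that psubset.prems(1)[of d] unfolding induced_cycle_def by auto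
    have psd: "0 \<le> quad B L y" if "L \<in> clique_complex ?W E" for L y
      using that psubset.prems(2)[of L y] by (auto simp: clique_complex_def)
    from psubset.IH[OF sub ind psd] obtain m :: nat and g where
      g: "\<And>i j. i \<in> ?W \<Longrightarrow> j \<in> ?W \<Longrightarrow> i = j \<or> {i, j} \<in> E \<Longrightarrow> B i j = (\<Sum>k<m. g k i * g k j)" by blast
    \<comment> \<open>The Schur complement of the block on \<open>K\<close>. It is the value of the
      form at the vector with entries \<open>c\<close> on \<open>K\<close> and -1 at
      \<open>v\<close>, hence nonnegative.\<close>
    define s where "s = B v v - (\<Sum>i\<in>K. B i v * c i)"
    have row: "(\<Sum>j\<in>K. B i j * c i * c j) = B i v * c i" if "i \<in> K" for i
      unfolding c[OF that] sum_distrib_right by (intro sum.cong) auto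
    have s: "0 \<le> s"
    proof -
      let ?y = "\<lambda>i. if i = v then -1 else c i"
      have "quad B K ?y = quad B K c" using vK by (intro quad_cong) auto
      also have "\<dots> = (\<Sum>i\<in>K. B i v * c i)" unfolding quad_def using row by simp
      finally have "quad B K ?y = (\<Sum>i\<in>K. B i v * c i)" .
      moreover have "(\<Sum>j\<in>K. B v j * ?y j) = (\<Sum>j\<in>K. B j v * c j)"
      proof (rule sum.cong[OF refl])
        fix j assume "j \<in> K"
        then show "B v j * ?y j = B j v * c j" using vK sym[of v j] by auto
      qed
      ultimately have "quad B (insert v K) ?y = s"
        unfolding quad_insert[OF finK vK sym] by (simp add: s_def)
      with psdK[of ?y] show ?thesis by simp
    qed
    \<comment> \<open>Coordinate \<open>m\<close> is the new direction: it is \<open>sqrt s\<close>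
      at \<open>v\<close> and 0 elsewhere, so it affects only the diagonal entry of
      \<open>v\<close>.\<close>
    define h where "h = (\<lambda>k i. if k < m then (if i = v then \<Sum>j\<in>K. c j * g k j else g k i)
      else if i = v then sqrt s else 0)"
    have gK: "(\<Sum>k<m. g k i * g k j) = B i j" if "i \<in> K" "j \<in> K" for i j
      by (rule g[symmetric]) (use adjK that KW in auto)
    have hv: "(\<Sum>k<Suc m. h k i * h k v) = B i v" if "i \<in> K" for i
    proof -
      have iv: "i \<noteq> v" using that vK by auto
      have "(\<Sum>k<Suc m. h k i * h k v) = (\<Sum>k<m. g k i * (\<Sum>j\<in>K. c j * g k j))"
        using iv by (simp add: h_def)
      also have "\<dots> = (\<Sum>j\<in>K. c j * (\<Sum>k<m. g k i * g k j))"
        unfolding sum_distrib_left by (subst sum.swap) (simp add: mult_ac)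
      also have "\<dots> = B i v" using c[OF that] gK[OF that] by (simp add: mult.commute)
      finally show ?thesis .
    qed
    have hvv: "(\<Sum>k<Suc m. h k v * h k v) = B v v"
    proof -
      have "(\<Sum>k<Suc m. h k v * h k v)
          = (\<Sum>k<m. (\<Sum>i\<in>K. c i * g k i) * (\<Sum>j\<in>K. c j * g k j)) + s"
        using s by (simp add: h_def)
      also have "(\<Sum>k<m. (\<Sum>i\<in>K. c i * g k i) * (\<Sum>j\<in>K. c j * g k j))
          = (\<Sum>i\<in>K. \<Sum>j\<in>K. c i * c j * (\<Sum>k<m. g k i * g k j))"
      proof -
        have "(\<Sum>k<m. (\<Sum>i\<in>K. c i * g k i) * (\<Sum>j\<in>K. c j * g k j))
            = (\<Sum>i\<in>K. \<Sum>j\<in>K. \<Sum>k<m. c i * g k i * (c j * g k j))"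
          unfolding sum_product by (rule trans[OF sum.swap sum.cong[OF refl sum.swap]])
        then show ?thesis by (simp add: sum_distrib_left mult_ac)
      qed
      also have "\<dots> = (\<Sum>i\<in>K. \<Sum>j\<in>K. B i j * c i * c j)"
        using gK by (intro sum.cong refl) (simp add: mult_ac)
      also have "\<dots> = (\<Sum>i\<in>K. B i v * c i)" using row by (intro sum.cong refl)
      finally show ?thesis by (simp add: s_def)
    qed
    have "B i j = (\<Sum>k<Suc m. h k i * h k j)"
      if ij: "i \<in> W" "j \<in> W" "i = j \<or> {i, j} \<in> E" for i j
    proof -
      consider "i \<noteq> v" "j \<noteq> v" | "i = v" "j = v" | "i = v" "j \<in> K" | "i \<in> K" "j = v"
        using ij unfolding K_def by (cases "i = v"; cases "j = v") (auto simp: insert_commute[of _ v])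
      then show ?thesis
      proof cases
        case 1
        then show ?thesis using g[of i j] ij by (auto simp: h_def)
      next
        case 2
        then show ?thesis using hvv by simp
      next
        case 3
        have "(\<Sum>k<Suc m. h k v * h k j) = (\<Sum>k<Suc m. h k j * h k v)"
          by (simp only: mult.commute)
        with 3 hv[of j] sym[of v j] show ?thesis by metis
      next
        case 4
        then show ?thesis using hv by metis
      qed
    qed
    then show ?thesis by blast
  qed simp
qed

section \<open>Quadratic forms in the face ring\<close>

definition monom_degree :: "('a \<Rightarrow>\<^sub>0 nat) \<Rightarrow> nat" where
  "monom_degree m = (\<Sum>i\<in>Poly_Mapping.keys m. Poly_Mapping.lookup m i)"

lemma monom_degree_superset:
  assumes "finite A" "Poly_Mapping.keys m \<subseteq> A"
  shows "monom_degree m = (\<Sum>i\<in>A. Poly_Mapping.lookup m i)"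
  unfolding monom_degree_def using assms
  by (intro sum.mono_neutral_left) (auto simp: in_keys_iff)

lemma monom_degree_add: "monom_degree (a + b) = monom_degree a + monom_degree b"
proof -
  let ?A = "Poly_Mapping.keys a \<union> Poly_Mapping.keys b"
  have "monom_degree m = (\<Sum>i\<in>?A. Poly_Mapping.lookup m i)" if "Poly_Mapping.keys m \<subseteq> ?A" for m
    using that by (intro monom_degree_superset) auto
  from this[of a] this[of b] this[of "a + b"] show ?thesis
    using Poly_Mapping.keys_add[of a b] by (simp add: lookup_add sum.distrib)
qed

lemma homogeneous_iff: "homogeneous d p \<longleftrightarrow> (\<forall>m\<in>Poly_Mapping.keys p. monom_degree m = d)"
  by (simp add: homogeneous_def monom_degree_def)

lemma homogeneous_mult: "homogeneous d p \<Longrightarrow> homogeneous e q \<Longrightarrow> homogeneous (d + e) (p * q)"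
  using keys_mult[of p q] unfolding homogeneous_iff by (fastforce simp: monom_degree_add)

lemma homogeneous_diff: "homogeneous d p \<Longrightarrow> homogeneous d q \<Longrightarrow> homogeneous d (p - q)"
  using keys_diff[of p q] unfolding homogeneous_iff by blast

definition linear_form :: "'a set \<Rightarrow> ('a \<Rightarrow> real) \<Rightarrow> 'a rpoly" where
  "linear_form F b = (\<Sum>i\<in>F. Poly_Mapping.single (Poly_Mapping.single i 1) (b i))"

lemma keys_linear_form:
  "Poly_Mapping.keys (linear_form F b) \<subseteq> (\<lambda>i. Poly_Mapping.single i 1) ` F"
proof -
  have "Poly_Mapping.keys (linear_form F b)
      \<subseteq> (\<Union>i\<in>F. Poly_Mapping.keys (Poly_Mapping.single (Poly_Mapping.single i 1) (b i)))"
    unfolding linear_form_def by (rule keys_sum)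
  also have "\<dots> \<subseteq> (\<lambda>i. Poly_Mapping.single i 1) ` F" by auto
  finally show ?thesis .
qed

lemma linear_form_carrier: "linear_form F b \<in> carrier (poly_ring F)"
  using keys_linear_form[of F b] by (auto simp: poly_ring_def)

lemma homogeneous_linear_form: "homogeneous 1 (linear_form F b)"
  using keys_linear_form[of F b] by (auto simp: homogeneous_def)

lemma poly_eval_linear_form: "poly_eval (linear_form F b) x = (\<Sum>i\<in>F. b i * x i)"
  by (simp add: linear_form_def poly_eval_sum poly_eval_single)

lemma linear_form_scale: "linear_form F (\<lambda>i. c * b i) = const c * linear_form F b"
  by (simp add: linear_form_def const_def sum_distrib_left mult_single)

lemma const_mult: "const a * const b = const (a * b)"
  by (simp add: const_def mult_single)

lemma const_add: "const a + const b = const (a + b)"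
  by (simp add: const_def single_add)

lemma const_1: "const 1 = 1"
  by (simp add: const_def)

lemma const_carrier: "const c \<in> carrier (poly_ring V)"
  by (auto simp: const_def poly_ring_def)

section \<open>Symmetric matrices of quadratic forms\<close>

lemma degree_2_monomial:
  assumes "monom_degree m = 2" "Poly_Mapping.keys m \<subseteq> V"
  obtains i j where "i \<in> V" "j \<in> V" "m = Poly_Mapping.single i 1 + Poly_Mapping.single j 1"
proof -
  \<comment> \<open>Subtraction of exponents truncates at 0, but it is exact here because
    \<open>i\<close> occurs in \<open>n\<close>.\<close>
  have split: "\<exists>i. i \<in> Poly_Mapping.keys n \<and> n = Poly_Mapping.single i 1 + (n - Poly_Mapping.single i 1)"
    if "monom_degree n > 0" for n :: "'a \<Rightarrow>\<^sub>0 nat"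
  proof -
    from that obtain i where i: "i \<in> Poly_Mapping.keys n" unfolding monom_degree_def by fastforce
    then have "n = Poly_Mapping.single i 1 + (n - Poly_Mapping.single i 1)"
      by (intro poly_mapping_eqI) (auto simp: lookup_add lookup_minus lookup_single when_def in_keys_iff)
    with i show ?thesis by blast
  qed
  have one: "monom_degree (Poly_Mapping.single i 1) = 1" for i :: 'a
    by (simp add: monom_degree_def)
  obtain i m' where i: "i \<in> Poly_Mapping.keys m" "m = Poly_Mapping.single i 1 + m'"
    using split[of m] assms(1) by (metis zero_less_numeral)
  then have m': "monom_degree m' = 1" using assms monom_degree_add one by (metis add_left_cancel nat_1_add_1)
  then obtain j r where j: "m' = Poly_Mapping.single j 1 + r" using split[of m'] by auto
  then have "monom_degree r = 0" using m' monom_degree_add[of "Poly_Mapping.single j 1" r] one[of j] by simp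
  then have "r = 0" unfolding monom_degree_def
    by (intro poly_mapping_eqI) (auto simp: in_keys_iff)
  then have m: "m = Poly_Mapping.single i 1 + Poly_Mapping.single j 1" using i j by simp
  then have "j \<in> Poly_Mapping.keys m" by (simp add: in_keys_iff lookup_add lookup_single)
  then show ?thesis using that i m assms by blast
qed

lemma quadratic_form_matrix:
  assumes "finite V" "p \<in> carrier (poly_ring V)" "homogeneous 2 p"
  obtains A where "\<And>i j. A i j = A j i" "\<And>x. poly_eval p x = quad A V x"
proof -
  define M where "M = Poly_Mapping.keys p"
  have "\<exists>i j. i \<in> V \<and> j \<in> V \<and> m = Poly_Mapping.single i 1 + Poly_Mapping.single j 1"
    if "m \<in> M" for m
  proof (rule degree_2_monomial)
    show "monom_degree m = 2" using that assms(3) by (simp add: homogeneous_iff M_def)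
    show "Poly_Mapping.keys m \<subseteq> V" using that assms(2) by (simp add: poly_ring_def M_def)
  qed blast
  then obtain f g where fg: "\<And>m. m \<in> M \<Longrightarrow> f m \<in> V \<and> g m \<in> V \<and>
      m = Poly_Mapping.single (f m) 1 + Poly_Mapping.single (g m) 1"
    by metis
  \<comment> \<open>Half of each coefficient goes to each of the two mirrored positions; for a
    square both halves meet on the diagonal. Nested conditionals let the double sums collapse one
    index at a time.\<close>
  define A where "A = (\<lambda>i j. \<Sum>m\<in>M. Poly_Mapping.lookup p m / 2 *
    ((if i = f m then if j = g m then 1 else 0 else 0) + (if j = f m then if i = g m then 1 else 0 else 0)))"
  have "A i j = A j i" for i j unfolding A_def by (simp add: add.commute)
  moreover have "poly_eval p x = quad A V x" for x
  proof -
    have monom: "poly_eval (Poly_Mapping.single m c) x = c * (x (f m) * x (g m))" if "m \<in> M" for m c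
    proof -
      have m: "Poly_Mapping.single (f m) 1 + Poly_Mapping.single (g m) 1 = m"
        using fg[OF that] by metis
      have "const c * (var (f m) * var (g m))
          = Poly_Mapping.single (Poly_Mapping.single (f m) 1 + Poly_Mapping.single (g m) 1) c"
        by (simp add: const_def var_def mult_single)
      then have "Poly_Mapping.single m c = const c * (var (f m) * var (g m))" by (simp only: m)
      then show ?thesis by (simp only: poly_eval_mult poly_eval_const poly_eval_var)
    qed
    have "quad A V x = (\<Sum>i\<in>V. \<Sum>j\<in>V. \<Sum>m\<in>M. Poly_Mapping.lookup p m / 2 *
       ((if i = f m then if j = g m then x i * x j else 0 else 0)
        + (if j = f m then if i = g m then x i * x j else 0 else 0)))"
      unfolding quad_def A_def sum_distrib_right by (intro sum.cong refl) auto
    also have "\<dots> = (\<Sum>m\<in>M. Poly_Mapping.lookup p m / 2 * (\<Sum>i\<in>V. \<Sum>j\<in>V.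
       ((if i = f m then if j = g m then x i * x j else 0 else 0)
        + (if j = f m then if i = g m then x i * x j else 0 else 0))))"
      unfolding sum_distrib_left
      by (rule trans[OF sum.cong[OF refl sum.swap] sum.swap])
    also have "\<dots> = (\<Sum>m\<in>M. Poly_Mapping.lookup p m * (x (f m) * x (g m)))"
    proof (rule sum.cong[OF refl])
      fix m assume m: "m \<in> M"
      have "(\<Sum>i\<in>V. \<Sum>j\<in>V. if i = f m then if j = g m then x i * x j else 0 else 0) = x (f m) * x (g m)"
      proof -
        have "(\<Sum>i\<in>V. \<Sum>j\<in>V. if i = f m then if j = g m then x i * x j else 0 else 0)
          = (\<Sum>i\<in>V. if i = f m then x i * x (g m) else 0)"
          using fg[OF m] assms(1) by (intro sum.cong) auto
        then show ?thesis using fg[OF m] assms(1) by simp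
      qed
      moreover have "(\<Sum>i\<in>V. \<Sum>j\<in>V. if j = f m then if i = g m then x i * x j else 0 else 0) = x (f m) * x (g m)"
      proof -
        have "(\<Sum>i\<in>V. \<Sum>j\<in>V. if j = f m then if i = g m then x i * x j else 0 else 0)
          = (\<Sum>i\<in>V. if i = g m then x i * x (f m) else 0)"
          using fg[OF m] assms(1) by (intro sum.cong) auto
        then show ?thesis using fg[OF m] assms(1) by (simp add: mult.commute)
      qed
      ultimately show "Poly_Mapping.lookup p m / 2 * (\<Sum>i\<in>V. \<Sum>j\<in>V.
       ((if i = f m then if j = g m then x i * x j else 0 else 0)
        + (if j = f m then if i = g m then x i * x j else 0 else 0)))
        = Poly_Mapping.lookup p m * (x (f m) * x (g m))"
        by (simp add: sum.distrib)
    qed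
    also have "\<dots> = poly_eval (\<Sum>m\<in>M. Poly_Mapping.single m (Poly_Mapping.lookup p m)) x"
      using monom by (simp add: poly_eval_sum)
    finally show ?thesis by (simp add: M_def rpoly_sum_monomials)
  qed
  ultimately show ?thesis by (rule that)
qed

section \<open>Residue classes modulo the face ideal\<close>

lemma poly_ring_simps [simp]:
  "add (poly_ring V) = (+)" "mult (poly_ring V) = (*)" "\<zero>\<^bsub>poly_ring V\<^esub> = 0" "\<one>\<^bsub>poly_ring V\<^esub> = 1"
  by (simp_all add: poly_ring_def)

lemma poly_ring_closed:
  assumes "p \<in> carrier (poly_ring V)" "q \<in> carrier (poly_ring V)"
  shows "p + q \<in> carrier (poly_ring V)" "p * q \<in> carrier (poly_ring V)" "p - q \<in> carrier (poly_ring V)"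
proof -
  interpret cring "poly_ring V" by (rule poly_ring_cring)
  show "p + q \<in> carrier (poly_ring V)" "p * q \<in> carrier (poly_ring V)"
    using a_closed[OF assms] m_closed[OF assms] by simp_all
  show "p - q \<in> carrier (poly_ring V)"
    using assms keys_diff[of p q] unfolding poly_ring_def by fastforce
qed

lemma residue_class_carrier:
  "p \<in> carrier (poly_ring (vertices \<Delta>)) \<Longrightarrow> residue_class \<Delta> p \<in> carrier (face_ring \<Delta>)"
  using ring_hom_memE(1)[OF ideal.rcos_ring_hom[OF ideal_face_ideal[of \<Delta>]]]
  unfolding residue_class_def face_ring_def by simp

lemma residue_class_hom:
  assumes "p \<in> carrier (poly_ring (vertices \<Delta>))" "q \<in> carrier (poly_ring (vertices \<Delta>))"
  shows "residue_class \<Delta> (p + q) = residue_class \<Delta> p \<oplus>\<^bsub>face_ring \<Delta>\<^esub> residue_class \<Delta> q"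
    and "residue_class \<Delta> (p * q) = residue_class \<Delta> p \<otimes>\<^bsub>face_ring \<Delta>\<^esub> residue_class \<Delta> q"
  using ring_hom_memE[OF ideal.rcos_ring_hom[OF ideal_face_ideal[of \<Delta>]]] assms
  unfolding residue_class_def face_ring_def by simp_all

lemma residue_class_eq_zero_iff:
  assumes "p \<in> carrier (poly_ring (vertices \<Delta>))"
  shows "residue_class \<Delta> p = \<zero>\<^bsub>face_ring \<Delta>\<^esub> \<longleftrightarrow> p \<in> face_ideal \<Delta>"
proof -
  interpret ideal "face_ideal \<Delta>" "poly_ring (vertices \<Delta>)" by (rule ideal_face_ideal)
  have "\<zero>\<^bsub>face_ring \<Delta>\<^esub> = face_ideal \<Delta>" by (simp add: face_ring_def FactRing_def)
  then show ?thesis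
    using a_rcos_zero[OF ideal_axioms, of p] rcos_const_imp_mem[OF assms]
    unfolding residue_class_def by auto
qed

lemma residue_class_eqI:
  assumes p: "p \<in> carrier (poly_ring (vertices \<Delta>))" and h: "h \<in> face_ideal \<Delta>"
  shows "residue_class \<Delta> (p + h) = residue_class \<Delta> p"
proof -
  interpret I: ideal "face_ideal \<Delta>" "poly_ring (vertices \<Delta>)" by (rule ideal_face_ideal)
  interpret F: cring "face_ring \<Delta>" by (rule cring_face_ring)
  have hR: "h \<in> carrier (poly_ring (vertices \<Delta>))" using h by (rule I.Icarr)
  show ?thesis
    using residue_class_hom(1)[OF p hR] residue_class_carrier[OF p] residue_class_eq_zero_iff[OF hR] h
    by simp
qed

lemma square_in_sos_forms:
  "residue_class \<Delta> (linear_form (vertices \<Delta>) b * linear_form (vertices \<Delta>) b) \<in> sos_forms \<Delta>"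
proof -
  interpret F: cring "face_ring \<Delta>" by (rule cring_face_ring)
  let ?L = "linear_form (vertices \<Delta>) b"
  let ?r = "residue_class \<Delta> ?L"
  have r: "?r \<in> carrier (face_ring \<Delta>)" by (intro residue_class_carrier linear_form_carrier)
  have "finsum (face_ring \<Delta>) (\<lambda>j :: nat. ?r \<otimes>\<^bsub>face_ring \<Delta>\<^esub> ?r) {..<1} = ?r \<otimes>\<^bsub>face_ring \<Delta>\<^esub> ?r"
    using r by (simp add: lessThan_Suc)
  then have "residue_class \<Delta> (?L * ?L) = finsum (face_ring \<Delta>) (\<lambda>j :: nat. ?r \<otimes>\<^bsub>face_ring \<Delta>\<^esub> ?r) {..<1}"
    by (simp add: residue_class_hom linear_form_carrier)
  moreover have "?r \<in> forms 1 \<Delta>"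
    unfolding forms_def using linear_form_carrier homogeneous_linear_form by blast
  ultimately show ?thesis unfolding sos_forms_def mem_Collect_eq
    by (intro exI[of _ "1 :: nat"] exI[of _ "\<lambda>_. ?r"]) simp
qed

lemma residue_class_nonneg:
  assumes "simplicial_complex \<Delta>" "p \<in> carrier (poly_ring (vertices \<Delta>))" "homogeneous 2 p"
  shows "residue_class \<Delta> p \<in> nonneg_forms \<Delta> \<longleftrightarrow> (\<forall>x\<in>realization \<Delta>. 0 \<le> poly_eval p x)"
  using assms class_eval_residue_class[OF assms(1) _ assms(2)]
  unfolding nonneg_forms_def forms_def by auto

text \<open>Both \<open>l\<^sup>2\<close> and \<open>p - l\<^sup>2\<close> are nonnegative, so
  extremality makes their classes linearly dependent. If \<open>l\<close> were nonzero at a vertex,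
  the class of \<open>p\<close> would be a nonnegative multiple of that of \<open>l\<^sup>2\<close>,
  hence a sum of squares.\<close>

lemma extreme_not_sos_dominates_no_square:
  assumes \<Delta>: "simplicial_complex \<Delta>"
    and p: "p \<in> carrier (poly_ring (vertices \<Delta>))" "homogeneous 2 p"
    and ext: "spans_extreme_ray \<Delta> (nonneg_forms \<Delta>) (residue_class \<Delta> p)"
    and sos: "residue_class \<Delta> p \<notin> sos_forms \<Delta>"
    and dom: "\<And>x. x \<in> realization \<Delta> \<Longrightarrow> (\<Sum>i\<in>vertices \<Delta>. b i * x i)\<^sup>2 \<le> poly_eval p x"
    and i: "i \<in> vertices \<Delta>"
  shows "b i = 0"
proof (rule ccontr)
  assume bi: "b i \<noteq> 0"
  let ?V = "vertices \<Delta>"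
  let ?R = "poly_ring ?V"
  let ?L = "linear_form ?V b"
  let ?y = "?L * ?L"
  let ?z = "p - ?L * ?L"
  interpret I: ideal "face_ideal \<Delta>" ?R by (rule ideal_face_ideal)
  have L: "?L \<in> carrier ?R" by (rule linear_form_carrier)
  have y: "?y \<in> carrier ?R" "homogeneous 2 ?y"
    using poly_ring_closed(2)[OF L L] homogeneous_mult[OF homogeneous_linear_form homogeneous_linear_form, of ?V b ?V b]
    by (simp_all add: numeral_2_eq_2)
  have z: "?z \<in> carrier ?R" "homogeneous 2 ?z"
    using poly_ring_closed(3)[OF p(1) y(1)] homogeneous_diff[OF p(2) y(2)] .
  have evy: "poly_eval ?y x = (\<Sum>i\<in>?V. b i * x i)\<^sup>2" for x
    by (simp add: poly_eval_mult poly_eval_linear_form power2_eq_square)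
  have evz: "poly_eval p x = poly_eval ?y x + poly_eval ?z x" for x
    using poly_eval_add[of ?y ?z x] by simp
  have "residue_class \<Delta> ?y \<in> nonneg_forms \<Delta>"
    by (subst residue_class_nonneg[OF \<Delta> y]) (simp add: evy)
  moreover have "residue_class \<Delta> ?z \<in> nonneg_forms \<Delta>"
    using dom evz by (subst residue_class_nonneg[OF \<Delta> z]) (auto simp: evy)
  moreover have "residue_class \<Delta> p = residue_class \<Delta> ?y \<oplus>\<^bsub>face_ring \<Delta>\<^esub> residue_class \<Delta> ?z"
    using residue_class_hom(1)[OF y(1) z(1)] by simp
  ultimately have "\<not> lin_indep2 \<Delta> (residue_class \<Delta> ?y) (residue_class \<Delta> ?z)"
    using ext unfolding spans_extreme_ray_def by blast
  then obtain s t where st: "s \<noteq> 0 \<or> t \<noteq> 0"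
    "scale \<Delta> s (residue_class \<Delta> ?y) \<oplus>\<^bsub>face_ring \<Delta>\<^esub> scale \<Delta> t (residue_class \<Delta> ?z) = \<zero>\<^bsub>face_ring \<Delta>\<^esub>"
    unfolding lin_indep2_def by blast
  let ?h = "const s * ?y + const t * ?z"
  have c: "const c * q \<in> carrier ?R" if "q \<in> carrier ?R" for c q
    using poly_ring_closed(2)[OF const_carrier that] .
  have "residue_class \<Delta> ?h = \<zero>\<^bsub>face_ring \<Delta>\<^esub>"
    using st(2) unfolding scale_def
    by (simp add: residue_class_hom(1)[OF c[OF y(1)] c[OF z(1)]]
        residue_class_hom(2)[OF const_carrier y(1)] residue_class_hom(2)[OF const_carrier z(1)])
  then have h: "?h \<in> face_ideal \<Delta>"
    using residue_class_eq_zero_iff[OF poly_ring_closed(1)[OF c[OF y(1)] c[OF z(1)]]] by blast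
  \<comment> \<open>The unit vector at \<open>i\<close> lies in the realization because
    \<open>{i}\<close> is a face. Evaluation there turns the relation modulo the ideal into a scalar
    equation.\<close>
  define e where "e = (\<lambda>j. if j = i then 1 else 0 :: real)"
  have eR: "e \<in> realization \<Delta>"
    using simplicial_complex_singleton[OF \<Delta> i] unfolding realization_def coord_space_def e_def by auto
  have e: "poly_eval ?h e = 0" "0 \<le> poly_eval p e"
    using face_ideal_eval[OF \<Delta> eR h] order_trans[OF zero_le_power2 dom[OF eR]] .
  have ye: "poly_eval ?y e = (b i)\<^sup>2"
  proof -
    have "finite ?V" using \<Delta> by (simp add: simplicial_complex_def)
    then have "(\<Sum>j\<in>?V. b j * e j) = b i" using i by (simp add: e_def if_distrib cong: if_cong)
    then show ?thesis by (simp add: evy)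
  qed
  have he: "s * (b i)\<^sup>2 + t * (poly_eval p e - (b i)\<^sup>2) = 0"
    using e(1) evz[of e] by (simp add: poly_eval_add poly_eval_mult[of "const _"] ye)
  have t: "t \<noteq> 0" using he st(1) bi by auto
  \<comment> \<open>Solving the dependence for \<open>p\<close> gives \<open>d\<close> as the factor
    of \<open>l\<^sup>2\<close>; its sign is read off from the value of \<open>p\<close> at
    \<open>e\<close>.\<close>
  define d where "d = 1 - s / t"
  have "poly_eval p e = d * (b i)\<^sup>2" using he t by (simp add: d_def field_simps)
  with e(2) bi have d: "0 \<le> d" by (simp add: zero_le_mult_iff)
  let ?L' = "linear_form ?V (\<lambda>i. sqrt d * b i)"
  have L': "?L' * ?L' = const d * ?y"
  proof -
    have "?L' * ?L' = (const (sqrt d) * const (sqrt d)) * ?y"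
      by (simp add: linear_form_scale mult_ac)
    then show ?thesis using d by (simp add: const_mult)
  qed
  have "const d * ?y + const (1 / t) * ?h
      = const d * ?y + (const (s / t) * ?y + const 1 * ?z)"
    using t by (simp add: distrib_left mult.assoc[symmetric] const_mult)
  also have "\<dots> = const (d + s / t) * ?y + ?z"
    unfolding const_add[symmetric] const_1 by (simp add: distrib_right add.assoc)
  also have "\<dots> = p" by (simp add: d_def const_1)
  finally have pe: "p = ?L' * ?L' + const (1 / t) * ?h" by (simp add: L')
  have "const (1 / t) * ?h \<in> face_ideal \<Delta>"
    using I.I_l_closed[OF h const_carrier] by simp
  from residue_class_eqI[OF poly_ring_closed(2)[OF linear_form_carrier linear_form_carrier] this]
  have "residue_class \<Delta> (?L' * ?L' + const (1 / t) * ?h) = residue_class \<Delta> (?L' * ?L')" .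
  then have "residue_class \<Delta> p = residue_class \<Delta> (?L' * ?L')"
    unfolding pe[symmetric] .
  then show False using sos square_in_sos_forms[of \<Delta> "\<lambda>i. sqrt d * b i"] by (simp only: not_True_eq_False)
qed

section \<open>The local rank of extreme forms\<close>

text \<open>Ensures that the infimum defining the deficiency is attained. The void complex has no
  chordal quotient, since a clique complex contains the empty face and its image would have to be a
  face.\<close>

lemma chordal_quotient_exists:
  fixes \<Delta> :: "'a set set"
  assumes \<Delta>: "simplicial_complex \<Delta>" and ne: "\<Delta> \<noteq> {}"
  obtains \<Gamma> :: "nat set set" and \<phi> where "chordal_quotient \<Gamma> \<phi> \<Delta>"
proof -
  \<comment> \<open>The disjoint union of the faces, each taken as a full simplex.\<close>
  define V where "V = (SIGMA F:\<Delta>. F)"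
  define E where "E = {{(F, u), (F, v)} | F u v. F \<in> \<Delta> \<and> u \<in> F \<and> v \<in> F \<and> u \<noteq> v}"
  have fin: "finite V"
    unfolding V_def using \<Delta> simplicial_complex_finite[OF \<Delta>]
    by (intro finite_SigmaI) (auto simp: simplicial_complex_def vertices_def intro: finite_subset)
  have edge: "{(F, u), (G, v)} \<in> E \<longleftrightarrow> F = G \<and> F \<in> \<Delta> \<and> u \<in> F \<and> v \<in> F \<and> u \<noteq> v" for F G u v
    unfolding E_def by (auto simp: doubleton_eq_iff)
  have "simple_graph V E"
    unfolding simple_graph_def using fin by (auto simp: E_def V_def)
  \<comment> \<open>Components of this graph are cliques, so the ends of a path on three distinct
    vertices are adjacent.\<close>
  moreover have False if c: "induced_cycle V E c" "4 \<le> length c" for c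
  proof -
    have adj: "{c ! i, c ! j} \<in> E \<longleftrightarrow> j = (i + 1) mod length c \<or> i = (j + 1) mod length c"
      if "i < length c" "j < length c" for i j
      using c that unfolding induced_cycle_def by blast
    have "distinct c" "0 < length c" "2 < length c"
      using c unfolding induced_cycle_def by auto
    then have "c ! 0 \<noteq> c ! 2" using nth_eq_iff_index_eq by fastforce
    moreover have "{c ! 0, c ! 1} \<in> E" "{c ! 1, c ! 2} \<in> E"
      using adj[of 0 1] adj[of 1 2] c(2) \<open>0 < length c\<close> by auto
    ultimately have "{c ! 0, c ! 2} \<in> E"
      using edge by (cases "c ! 0"; cases "c ! 1"; cases "c ! 2") auto
    \<comment> \<open>Length at least 4 enters here: in a triangle the index after 2 would wrap
      around to 0, and the adjacency would be no contradiction.\<close>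
    moreover have "3 mod length c = 3" using c(2) by (cases "length c = 3") auto
    ultimately show False using adj[of 0 2] c(2) \<open>0 < length c\<close> by auto
  qed
  ultimately have ch: "chordal_complex (clique_complex V E)"
    unfolding chordal_complex_def chordal_graph_def by blast
  obtain f :: "'a set \<times> 'a \<Rightarrow> nat" where f: "inj_on f V"
    using finite_imp_inj_to_nat_seg[OF fin] by blast
  let ?\<Gamma> = "(`) f ` clique_complex V E"
  let ?\<phi> = "\<lambda>n. snd (inv_into V f n)"
  have img: "?\<phi> ` (f ` T) = snd ` T" if "T \<subseteq> V" for T
    using that f by (force simp: image_image inv_into_f_f subset_iff)
  have face: "snd ` T \<in> \<Delta>" if T: "T \<in> clique_complex V E" for T
  proof (cases "T = {}")
    case True
    then show ?thesis using ne \<Delta> by (auto simp: simplicial_complex_def)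
  next
    case False
    then obtain F u where Fu: "(F, u) \<in> T" by auto
    then have F: "F \<in> \<Delta>" using T by (auto simp: clique_complex_def V_def)
    have "snd x \<in> F" if "x \<in> T" for x
    proof (cases "x = (F, u)")
      case True
      then show ?thesis using Fu T by (auto simp: clique_complex_def V_def)
    next
      case False
      then have "{x, (F, u)} \<in> E" using T Fu that by (auto simp: clique_complex_def)
      then show ?thesis using edge by (cases x) auto
    qed
    then show ?thesis using F \<Delta> unfolding simplicial_complex_def by (meson image_subsetI)
  qed
  have "chordal_quotient ?\<Gamma> ?\<phi> \<Delta>"
    unfolding chordal_quotient_def
  proof (intro conjI ballI)
    show "chordal_complex ?\<Gamma>" using f by (intro chordal_complex_image ch) simp
    have "?\<phi> ` S \<in> \<Delta>" if "S \<in> ?\<Gamma>" for S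
      using that face img by (auto simp: clique_complex_def)
    moreover have "?\<phi> \<in> vertices ?\<Gamma> \<rightarrow> vertices \<Delta>"
      using calculation unfolding vertices_def by blast
    ultimately show "simplicial_map ?\<Gamma> ?\<phi> \<Delta>" unfolding simplicial_map_def by blast
  next
    fix S assume S: "S \<in> \<Delta>"
    then have T: "Pair S ` S \<in> clique_complex V E"
      by (auto simp: clique_complex_def V_def edge)
    then have "?\<phi> ` (f ` (Pair S ` S)) = snd ` Pair S ` S"
      by (intro img) (simp add: clique_complex_def)
    also have "\<dots> = S" by (simp add: image_image)
    finally show "\<exists>T\<in>?\<Gamma>. S = ?\<phi> ` T" using T by blast
  qed
  then show ?thesis by (rule that)
qed

section \<open>Restrictions to faces and pullbacks\<close>

lemma sos_rank_le:
  fixes c :: "'k \<Rightarrow> 'a \<Rightarrow> real"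
  assumes "finite U" and f: "\<And>x. x \<in> coord_space F \<Longrightarrow> f x = (\<Sum>k\<in>U. (\<Sum>i\<in>F. c k i * x i)\<^sup>2)"
  shows "sos_rank F f \<le> card U"
  unfolding sos_rank_def
proof (rule Least_le)
  obtain e where e: "bij_betw e {..<card U} U"
    using ex_bij_betw_nat_finite[OF assms(1)] by (auto simp: lessThan_atLeast0)
  have "f x = (\<Sum>j<card U. (poly_eval (linear_form F (c (e j))) x)\<^sup>2)" if "x \<in> coord_space F" for x
    unfolding f[OF that] poly_eval_linear_form
    by (rule sum.reindex_bij_betw[OF e, of "\<lambda>k. (\<Sum>i\<in>F. c k i * x i)\<^sup>2", symmetric])
  then show "\<exists>l. (\<forall>j<card U. l j \<in> carrier (poly_ring F) \<and> homogeneous 1 (l j)) \<and>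
      (\<forall>x\<in>coord_space F. f x = (\<Sum>j<card U. (poly_eval (l j) x)\<^sup>2))"
    by (intro exI[of _ "\<lambda>j. linear_form F (c (e j))"] conjI allI impI ballI
        linear_form_carrier homogeneous_linear_form)
qed

lemma quad_coord_space:
  assumes "finite V" "F \<subseteq> V" "x \<in> coord_space F"
  shows "quad A V x = quad A F x"
proof -
  have z: "x i = 0" if "i \<notin> F" for i using assms(3) that by (simp add: coord_space_def)
  have "quad A V x = (\<Sum>i\<in>F. \<Sum>j\<in>V. A i j * x i * x j)"
    unfolding quad_def using assms(1,2) z by (intro sum.mono_neutral_right) auto
  also have "\<dots> = quad A F x"
    unfolding quad_def using assms(1,2) z by (intro sum.cong refl sum.mono_neutral_right) auto
  finally show ?thesis .
qed

text \<open>Pulling the matrix back along \<open>\<phi>\<close> corresponds to pushing the vector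
  forward by summing its entries over fibres. This carries nonnegativity from the faces of
  \<open>\<Delta>\<close> to those of \<open>\<Gamma>\<close>.\<close>

lemma quad_pullback:
  assumes "finite K"
  shows "quad (\<lambda>i j. A (\<phi> i) (\<phi> j)) K y = quad A (\<phi> ` K) (\<lambda>v. \<Sum>i\<in>{i \<in> K. \<phi> i = v}. y i)"
proof -
  let ?X = "\<lambda>v. \<Sum>i\<in>{i \<in> K. \<phi> i = v}. y i"
  have push: "(\<Sum>i\<in>K. h (\<phi> i) * y i) = (\<Sum>v\<in>\<phi> ` K. h v * ?X v)" for h :: "_ \<Rightarrow> real"
    unfolding sum.image_gen[OF assms, of "\<lambda>i. h (\<phi> i) * y i" \<phi>] sum_distrib_left
    by (intro sum.cong) auto
  have "quad (\<lambda>i j. A (\<phi> i) (\<phi> j)) K y = (\<Sum>i\<in>K. (\<Sum>j\<in>K. A (\<phi> i) (\<phi> j) * y j) * y i)"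
    unfolding quad_def sum_distrib_right by (intro sum.cong) auto
  also have "\<dots> = (\<Sum>u\<in>\<phi> ` K. (\<Sum>v\<in>\<phi> ` K. A u v * ?X v) * ?X u)"
    using push[of "\<lambda>u. \<Sum>v\<in>\<phi> ` K. A u v * ?X v"] push[of "A _"] by simp
  also have "\<dots> = quad A (\<phi> ` K) ?X"
    unfolding quad_def sum_distrib_right by (intro sum.cong refl) (simp add: mult_ac)
  finally show ?thesis .
qed

lemma quad_gram:
  assumes "\<And>u v. u \<in> F \<Longrightarrow> v \<in> F \<Longrightarrow> A u v = (\<Sum>k\<in>U. c k u * c k v)"
  shows "quad A F x = (\<Sum>k\<in>U. (\<Sum>v\<in>F. c k v * x v)\<^sup>2)"
proof -
  have "quad A F x = (\<Sum>u\<in>F. \<Sum>v\<in>F. \<Sum>k\<in>U. (c k u * x u) * (c k v * x v))"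
    unfolding quad_def
  proof (intro sum.cong refl)
    fix u v assume "u \<in> F" "v \<in> F"
    then show "A u v * x u * x v = (\<Sum>k\<in>U. (c k u * x u) * (c k v * x v))"
      unfolding assms[OF \<open>u \<in> F\<close> \<open>v \<in> F\<close>] sum_distrib_right by (intro sum.cong) auto
  qed
  also have "\<dots> = (\<Sum>k\<in>U. \<Sum>u\<in>F. \<Sum>v\<in>F. (c k u * x u) * (c k v * x v))"
    by (rule trans[OF sum.cong[OF refl sum.swap] sum.swap])
  also have "\<dots> = (\<Sum>k\<in>U. (\<Sum>v\<in>F. c k v * x v)\<^sup>2)"
    by (simp add: power2_eq_square sum_product)
  finally show ?thesis .
qed

lemma local_rank_le:
  assumes \<Delta>: "simplicial_complex \<Delta>" and quot: "chordal_quotient \<Gamma> \<phi> \<Delta>"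
    and q: "q \<in> nonneg_forms \<Delta>" "q \<notin> sos_forms \<Delta>" "spans_extreme_ray \<Delta> (nonneg_forms \<Delta>) q"
  shows "local_rank \<Delta> q \<le> card (vertices \<Gamma>) - card (vertices \<Delta>)"
proof -
  define V where "V = vertices \<Delta>"
  have finV: "finite V" using \<Delta> by (simp add: simplicial_complex_def V_def)
  obtain p where p: "p \<in> carrier (poly_ring V)" "homogeneous 2 p" "q = residue_class \<Delta> p"
    using q(1) unfolding nonneg_forms_def forms_def V_def by auto
  obtain A where symA: "\<And>i j. A i j = A j i" and A: "\<And>x. poly_eval p x = quad A V x"
    using quadratic_form_matrix[OF finV p(1,2)] by blast
  have eval: "class_eval q x = poly_eval p x" if "x \<in> realization \<Delta>" for x
    using class_eval_residue_class[OF \<Delta> that] p by (simp add: V_def)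
  have FV: "F \<subseteq> V" if "F \<in> \<Delta>" for F using that by (auto simp: V_def vertices_def)
  have evalF: "poly_eval p x = quad A F x" "x \<in> realization \<Delta>" if "F \<in> \<Delta>" "x \<in> coord_space F" for F x
    using A quad_coord_space[OF finV FV[OF that(1)] that(2)] that by (auto simp: realization_def)
  obtain W E where G: "chordal_graph W E" and \<Gamma>: "\<Gamma> = clique_complex W E"
    using quot unfolding chordal_quotient_def chordal_complex_def by blast
  have W: "vertices \<Gamma> = W" by (simp add: \<Gamma>)
  have finW: "finite W" and irr: "{u} \<notin> E" for u
    using G unfolding chordal_graph_def simple_graph_def by fastforce+
  have chordal: "length c < 4" if "induced_cycle W E c" for c
    using G that unfolding chordal_graph_def by (meson not_less)
  have map: "\<phi> ` T \<in> \<Delta>" if "T \<in> \<Gamma>" for T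
    using quot that unfolding chordal_quotient_def simplicial_map_def by blast
  have \<phi>V: "\<phi> i \<in> V" if "i \<in> W" for i
    using quot that unfolding chordal_quotient_def simplicial_map_def W V_def by blast
  have surj: "\<exists>T\<in>\<Gamma>. F = \<phi> ` T" if "F \<in> \<Delta>" for F
    using quot that unfolding chordal_quotient_def by blast
  define B where "B = (\<lambda>i j. A (\<phi> i) (\<phi> j))"
  \<comment> \<open>The diagonal and the edges of \<open>\<Gamma>\<close>: the entries of
    \<open>B\<close> that a Gram representation has to reproduce.\<close>
  define P where "P = {(i, j). i \<in> W \<and> j \<in> W \<and> (i = j \<or> {i, j} \<in> E)}"
  have psd: "0 \<le> quad B K y" if K: "K \<in> clique_complex W E" for K y
  proof -
    let ?X = "\<lambda>v. \<Sum>i\<in>{i \<in> K. \<phi> i = v}. y i"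
    have "finite K" using K finW by (auto simp: clique_complex_def intro: finite_subset)
    then have "quad B K y = quad A (\<phi> ` K) ?X" unfolding B_def by (rule quad_pullback)
    moreover have X: "?X \<in> coord_space (\<phi> ` K)"
      by (auto simp: coord_space_def intro!: sum.neutral)
    have K': "\<phi> ` K \<in> \<Delta>" using K map \<Gamma> by blast
    have "0 \<le> class_eval q ?X"
      using q(1) evalF(2)[OF K' X] unfolding nonneg_forms_def by blast
    ultimately show ?thesis using eval evalF[OF K' X] by simp
  qed
  \<comment> \<open>The section \<open>t\<close> has its image in a single face of
    \<open>\<Gamma>\<close>, so all pairs of lifted vertices are entries prescribed by
    \<open>P\<close>.\<close>
  have lift: "\<exists>t. (\<forall>v\<in>F. t v \<in> W \<and> \<phi> (t v) = v) \<and> (\<forall>u\<in>F. \<forall>v\<in>F. (t u, t v) \<in> P)"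
    if F: "F \<in> \<Delta>" for F
  proof -
    obtain T where T: "T \<in> \<Gamma>" "F = \<phi> ` T" using surj[OF F] by blast
    let ?t = "inv_into T \<phi>"
    have t: "?t v \<in> T" "\<phi> (?t v) = v" if "v \<in> F" for v
      using that T(2) by (auto intro: inv_into_into f_inv_into_f)
    have "(i, j) \<in> P" if "i \<in> T" "j \<in> T" for i j
      using that T(1) by (auto simp: P_def \<Gamma> clique_complex_def)
    moreover have "T \<subseteq> W" using T(1) by (simp add: \<Gamma> clique_complex_def)
    ultimately show ?thesis using t by (intro exI[of _ ?t]) blast
  qed
  \<comment> \<open>Stated for an arbitrary representation, since it serves both to dominate a
    square by \<open>p\<close> and to bound the rank after the reduction.\<close>
  have squares: "poly_eval p x = (\<Sum>k\<in>U. (\<Sum>v\<in>F. g k (t v) * x v)\<^sup>2)"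
    if gram: "\<And>i j. (i, j) \<in> P \<Longrightarrow> B i j = (\<Sum>k\<in>U. g k i * g k j)"
      and F: "F \<in> \<Delta>" "x \<in> coord_space F"
      and t: "\<And>v. v \<in> F \<Longrightarrow> \<phi> (t v) = v" "\<And>u v. u \<in> F \<Longrightarrow> v \<in> F \<Longrightarrow> (t u, t v) \<in> P"
    for U :: "nat set" and g F x t
  proof -
    have "A u v = (\<Sum>k\<in>U. g k (t u) * g k (t v))" if "u \<in> F" "v \<in> F" for u v
      using gram[OF t(2)[OF that]] t(1) that by (simp add: B_def)
    then show ?thesis unfolding evalF(1)[OF F] by (rule quad_gram)
  qed
  \<comment> \<open>A global choice of one vertex in each fibre. Unlike the lifts \<open>t\<close>,
    it need not send faces to faces. The unchosen vertices form \<open>Z\<close>, whose size is the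
    difference of the vertex counts.\<close>
  define \<sigma> where "\<sigma> = inv_into W \<phi>"
  have "V \<subseteq> \<phi> ` W"
  proof
    fix v assume "v \<in> V"
    then obtain t where "t v \<in> W" "\<phi> (t v) = v"
      using lift[of "{v}"] simplicial_complex_singleton[OF \<Delta>, of v] unfolding V_def by blast
    then show "v \<in> \<phi> ` W" by force
  qed
  then have \<sigma>: "\<sigma> v \<in> W" "\<phi> (\<sigma> v) = v" if "v \<in> V" for v
    using that unfolding \<sigma>_def by (auto intro: inv_into_into f_inv_into_f)
  define Z where "Z = W - \<sigma> ` V"
  have cardZ: "card Z = card W - card V"
  proof -
    have "inj_on \<sigma> V" using \<sigma>(2) by (metis inj_onI)
    then show ?thesis
      unfolding Z_def using \<sigma>(1) finV by (subst card_Diff_subset) (auto simp: card_image)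
  qed
  \<comment> \<open>A combination of the Gram coordinates that is constant on the fibres descends to
    a linear form on \<open>\<Delta>\<close>. The equations on \<open>Z\<close> express this
    constancy, as a chosen vertex represents its own fibre.\<close>
  have vanish: "\<forall>i\<in>W. (\<Sum>k\<in>U. a k * g k i) = 0"
    if fin: "finite U" and gram: "\<And>i j. (i, j) \<in> P \<Longrightarrow> B i j = (\<Sum>k\<in>U. g k i * g k j)"
      and const: "\<And>i. i \<in> Z \<Longrightarrow> (\<Sum>k\<in>U. a k * g k i) = (\<Sum>k\<in>U. a k * g k (\<sigma> (\<phi> i)))"
    for U :: "nat set" and g a
  proof (cases "(\<Sum>k\<in>U. (a k)\<^sup>2) = 0")
    case True
    then have "a k = 0" if "k \<in> U" for k using fin that by (simp add: sum_nonneg_eq_0_iff)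
    then show ?thesis by simp
  next
    case False
    \<comment> \<open>Scaling the coefficients to a unit vector lets Cauchy-Schwarz bound the square
      of the descended form by \<open>p\<close>.\<close>
    define r where "r = sqrt (\<Sum>k\<in>U. (a k)\<^sup>2)"
    have "0 \<le> (\<Sum>k\<in>U. (a k)\<^sup>2)" by (rule sum_nonneg) simp
    then have r: "r \<noteq> 0" "r\<^sup>2 = (\<Sum>k\<in>U. (a k)\<^sup>2)" using False by (simp_all add: r_def)
    define b where "b = (\<lambda>i. \<Sum>k\<in>U. a k / r * g k i)"
    have b: "b i = (\<Sum>k\<in>U. a k * g k i) / r" for i
      by (simp add: b_def sum_divide_distrib)
    have unit: "(\<Sum>k\<in>U. (a k / r)\<^sup>2) = 1"
      using r False by (simp add: power_divide sum_divide_distrib[symmetric])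
    have fibre: "b i = b (\<sigma> (\<phi> i))" if "i \<in> W" for i
    proof (cases "i \<in> Z")
      case True
      then show ?thesis unfolding b using const by simp
    next
      case False
      then show ?thesis using that \<sigma> by (auto simp: Z_def)
    qed
    have "b (\<sigma> v) = 0" if "v \<in> V" for v
    proof (rule extreme_not_sos_dominates_no_square[OF \<Delta>, of p])
      fix x assume "x \<in> realization \<Delta>"
      then obtain F where F: "F \<in> \<Delta>" "x \<in> coord_space F" by (auto simp: realization_def)
      obtain t where t: "\<And>v. v \<in> F \<Longrightarrow> t v \<in> W" "\<And>v. v \<in> F \<Longrightarrow> \<phi> (t v) = v"
        "\<And>u v. u \<in> F \<Longrightarrow> v \<in> F \<Longrightarrow> (t u, t v) \<in> P"
        using lift[OF F(1)] by blast
      have "(\<Sum>v\<in>V. b (\<sigma> v) * x v) = (\<Sum>v\<in>F. b (\<sigma> v) * x v)"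
        using finV FV[OF F(1)] F(2) by (intro sum.mono_neutral_right) (auto simp: coord_space_def)
      \<comment> \<open>The vertices \<open>\<sigma> v\<close> and \<open>t v\<close> lie in the
        same fibre, so the globally chosen representatives may be replaced by those lying in one
        face of \<open>\<Gamma>\<close>.\<close>
      also have "\<dots> = (\<Sum>v\<in>F. b (t v) * x v)"
        using fibre[OF t(1)] t(2) by (intro sum.cong) auto
      also have "\<dots> = (\<Sum>k\<in>U. a k / r * (\<Sum>v\<in>F. g k (t v) * x v))"
        unfolding b_def sum_distrib_right sum_distrib_left
        by (subst sum.swap) (simp add: mult_ac)
      finally have "(\<Sum>v\<in>V. b (\<sigma> v) * x v)\<^sup>2 \<le> (\<Sum>k\<in>U. (\<Sum>v\<in>F. g k (t v) * x v)\<^sup>2)"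
        using sum_mult_squared_le[OF unit] by simp
      also have "\<dots> = poly_eval p x" using squares[OF gram F t(2,3)] by simp
      finally show "(\<Sum>v\<in>vertices \<Delta>. b (\<sigma> v) * x v)\<^sup>2 \<le> poly_eval p x" by (simp add: V_def)
    qed (use p q that in \<open>auto simp: V_def\<close>)
    then have "b i = 0" if "i \<in> W" for i using fibre[OF that] \<phi>V[OF that] by simp
    then show ?thesis using r(1) by (simp add: b)
  qed
  have symB: "B i j = B j i" for i j unfolding B_def by (rule symA)
  obtain m :: nat and g where g: "\<forall>i\<in>W. \<forall>j\<in>W. i = j \<or> {i, j} \<in> E \<longrightarrow>
      B i j = (\<Sum>k<m. g k i * g k j)"
    using chordal_psd_completion[where B = B, OF finW irr chordal symB psd] by blast
  have P: "P \<subseteq> W \<times> W" by (auto simp: P_def)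
  have gP: "B i j = (\<Sum>k<m. g k i * g k j)" if "(i, j) \<in> P" for i j
    using that g by (auto simp: P_def)
  have finZ: "finite Z" using finW by (simp add: Z_def)
  have "\<exists>U (h :: nat \<Rightarrow> _). finite U \<and> card U \<le> card Z \<and>
      (\<forall>i j. (i, j) \<in> P \<longrightarrow> B i j = (\<Sum>k\<in>U. h k i * h k j))"
    using finite_lessThan finZ P gP
  proof (rule gram_reduction[where s = "\<lambda>i. \<sigma> (\<phi> i)"])
    show "\<forall>i\<in>W. (\<Sum>k\<in>U. a k * g k i) = 0"
      if "finite U" "\<And>i j. (i, j) \<in> P \<Longrightarrow> B i j = (\<Sum>k\<in>U. g k i * g k j)"
        "\<And>i. i \<in> Z \<Longrightarrow> (\<Sum>k\<in>U. a k * g k i) = (\<Sum>k\<in>U. a k * g k (\<sigma> (\<phi> i)))"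
      for U :: "nat set" and g a
      using that by (rule vanish)
  qed
  then obtain U :: "nat set" and h where U: "finite U" "card U \<le> card Z"
    and h: "\<And>i j. (i, j) \<in> P \<Longrightarrow> B i j = (\<Sum>k\<in>U. h k i * h k j)"
    by blast
  have rank: "sos_rank F (class_eval q) \<le> card Z" if F: "F \<in> \<Delta>" for F
  proof -
    obtain t where t: "\<And>v. v \<in> F \<Longrightarrow> \<phi> (t v) = v" "\<And>u v. u \<in> F \<Longrightarrow> v \<in> F \<Longrightarrow> (t u, t v) \<in> P"
      using lift[OF F] by blast
    have "sos_rank F (class_eval q) \<le> card U"
    proof (rule sos_rank_le[OF U(1)])
      fix x assume x: "x \<in> coord_space F"
      show "class_eval q x = (\<Sum>k\<in>U. (\<Sum>v\<in>F. h k (t v) * x v)\<^sup>2)"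
        unfolding eval[OF evalF(2)[OF F x]] by (rule squares[OF h F x t])
    qed
    then show ?thesis using U(2) by simp
  qed
  \<comment> \<open>The empty face maps to a face, so the maximum defining the local rank is over a
    nonempty set.\<close>
  have "{} \<in> \<Gamma>" by (simp add: \<Gamma> clique_complex_def)
  then have "\<Delta> \<noteq> {}" using map by blast
  then show ?thesis
    unfolding local_rank_def W V_def[symmetric] cardZ[symmetric]
    using rank simplicial_complex_finite[OF \<Delta>] by (subst Max_le_iff) auto
qed

text \<open>Without variables a form of degree 2 is zero. Hence the void complex, which has no
  chordal quotient, has no extreme ray either.\<close>

lemma nonneg_forms_void: "nonneg_forms {} \<subseteq> {\<zero>\<^bsub>face_ring {}\<^esub>}"
proof
  fix q :: "'a rpoly set" assume "q \<in> nonneg_forms {}"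
  then obtain p where p: "p \<in> carrier (poly_ring {})" "homogeneous 2 p" "q = residue_class {} p"
    by (auto simp: nonneg_forms_def forms_def vertices_def)
  have "m \<notin> Poly_Mapping.keys p" for m
    using p(1,2) unfolding poly_ring_def homogeneous_def by force
  then have "p = 0" by (simp flip: keys_eq_empty add: set_eq_iff del: keys_eq_empty)
  then show "q \<in> {\<zero>\<^bsub>face_ring {}\<^esub>}"
    using p residue_class_eq_zero_iff[of p "{}"] ideal.axioms(1)[OF ideal_face_ideal[of "{}"]]
      additive_subgroup.zero_closed by (fastforce simp: vertices_def)
qed

theorem theorem3p1:
  fixes \<Delta> :: "'a set set"
  assumes "simplicial_complex \<Delta>"
  shows "extreme_local_rank \<Delta> \<le> chordal_deficiency \<Delta>"
proof -
  let ?Q = "{q \<in> nonneg_forms \<Delta> - sos_forms \<Delta>. spans_extreme_ray \<Delta> (nonneg_forms \<Delta>) q}"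
  \<comment> \<open>In the first two cases the extreme local rank is 0: by definition for a chordal
    complex, and as the supremum of the empty set otherwise.\<close>
  consider "chordal_complex \<Delta>" | "?Q = {}" | "\<not> chordal_complex \<Delta>" "?Q \<noteq> {}" by blast
  then show ?thesis
  proof cases
    case 3
    have "\<Delta> \<noteq> {}"
      using 3(2) nonneg_forms_void unfolding spans_extreme_ray_def by blast
    then obtain \<Gamma>\<^sub>0 :: "nat set set" and \<phi>\<^sub>0 where "chordal_quotient \<Gamma>\<^sub>0 \<phi>\<^sub>0 \<Delta>"
      using chordal_quotient_exists[OF assms] by blast
    then have "chordal_deficiency \<Delta> \<in> {card (vertices \<Gamma>) - card (vertices \<Delta>) |
        (\<Gamma> :: nat set set) \<phi>. chordal_quotient \<Gamma> \<phi> \<Delta>}"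
      unfolding chordal_deficiency_def by (intro Inf_nat_def1) blast
    then obtain \<Gamma> :: "nat set set" and \<phi> where quot: "chordal_quotient \<Gamma> \<phi> \<Delta>" and
      "chordal_deficiency \<Delta> = card (vertices \<Gamma>) - card (vertices \<Delta>)" by blast
    then have "local_rank \<Delta> q \<le> chordal_deficiency \<Delta>" if "q \<in> ?Q" for q
      using local_rank_le[OF assms quot] that by simp
    then have "Sup (local_rank \<Delta> ` ?Q) \<le> chordal_deficiency \<Delta>"
      using 3(2) by (intro cSup_least) auto
    then show ?thesis using 3(1) by (simp add: extreme_local_rank_def)
  qed (simp_all add: extreme_local_rank_def Sup_nat_def)
qed

end
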